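(* Let $f\colon M\to S^4$ be an immersion of a discrete torus $M$ with regular combinatorics such that the quaternionic holomorphic line bundle $V/L$ satisfies the genericity assumption (G) given in the context. Then the spectral curve $\Sigma$ of $f$ is preserved under Darboux transforms: if $f^\sharp\colon M'\to S^4$ is an immersed Darboux transform of $f$, then the spectral curve of $f^\sharp$ coincides with the spectral curve of $f$.
   Context: Discrete tori. A discrete surface $M$ is the vertex set $\mathcal V$ of a triangulation of an oriented smooth surface whose faces are decomposed into black triangles $\mathcal B$ and white triangles $\mathcal W$ such that triangles of the same color never share an edge. The triangulation is a regular cellular decomposition (the three vertices and edges of a triangle are distinct), not necessarily simplicial. A discrete torus is one whose underlying surface is a torus; it has regular combinatorics if every vertex has valence six, equivalently if it is the quotient of the black and white colored equilateral triangulation of the plane by a lattice $\Gamma\cong\mathbb{Z}^2$ (the group of deck transformations). $M'$ is the cellular decomposition with vertex set $\mathcal B$, "black" faces $\mathcal W$, "white" faces $\mathcal V$, and edges corresponding to pairs $(w,v)$, $v$ a vertex of $w\in\mathcal W$, the edge $(w,v)$ joining the two black triangles adjacent to $w$ along the edges of $w$ incident to $v$. If $M$ is a discrete torus with regular combinatorics, so is $M'$, with the same group $\Gamma$. Holomorphic line bundles. A quaternionic line bundle $W$ over $M$ is a family of 1-dimensional right quaternionic vector spaces $W_p$, $p\in M$. A holomorphic structure assigns to each black triangle $b$ a quaternionic 2-dimensional subspace $U_b\subset\prod_{p\in b}W_p$ such that an element of $U_b$ vanishing at two vertices of $b$ vanishes at all three. A section $\psi$ is holomorphic if $\psi_{|b}\in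 U_b$ for all $b\in\mathcal B$. A holomorphic section with monodromy $h\in\mathrm{Hom}(\Gamma,\mathbb{C}_* )$ is a holomorphic section of the pullback of $W$ to the universal covering with $\gamma^*\psi=\psi h_\gamma$ for $\gamma\in\Gamma$ (with $\mathbb{C}=\mathrm{Span}_{\mathbb{R}}\{1,\mathbf{i}\}\subset\mathbb{H}$). $\mathrm{Spec}(W)\subset\mathrm{Hom}(\Gamma,\mathbb{C}_* )$ is the set of $h$ for which a non-trivial holomorphic section with monodromy $h$ exists; for tori with regular combinatorics it is a 1-dimensional algebraic set, and the spectral curve of $W$ is the Riemann surface $\Sigma$ normalizing it, with normalization map $h\colon\Sigma\to\mathrm{Spec}(W)$. Immersions and Darboux transforms. A map $f\colon M\to S^4=\mathbb{H}\mathbb{P}^1$ is identified with the line subbundle $L_p=f(p)$ of the trivial $\mathbb{H}^2$-bundle $V$; it is immersed if $f(p)\ne f(q)$ for adjacent $p,q$. The bundle $V/L$ carries the holomorphic structure for which $U_b$ is the image of $\mathbb{H}^2\to\prod_{p\in b}\mathbb{H}^2/L_p$; the spectral curve of an immersion $f$ is that of $V/L$ (and analogously for immersions of $M'$). A Darboux transform of $f$ is a map $f^\sharp\colon M'\to S^4$, with line bundle $L^\sharp$, such that $L^\sharp_b\ne L_v$ for every black triangle $b$ and vertex $v\in b$, and the connection on $L^\sharp$ given along the edge $(w,v)$ of $M'$ joining $b_1,b_2$ by $L^\sharp_{b_1}\to\mathbb{H}^2/L_v\to L^\sharp_{b_2}$ (projection followed by inverse projection) is flat, i.e. has trivial holonomy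 around all faces of $M'$. Adapted bases and (G) (with $W=V/L$). For each of the three edge directions there is a positively oriented basis $\gamma,\eta$ of $\Gamma$ with $\gamma$ parallel to the edges of this direction and such that the black triangles having an edge on the line of $\gamma$ lie on its positive side (the side of $\eta$); it is called adapted, and normalized if the angle between $\gamma$ and $\eta$ is at most $\pi/3$ and that between $\gamma$ and $\eta-\gamma$ is greater than $\pi/3$ (exactly one such basis per direction). Its thickness $m$ is the number of rows of vertices parallel to $\gamma$ modulo $\Gamma$. For the $i$-th row of vertices ($i=0,\dots,m-1$), two successive vertices $p,q$ of the row are the base of a unique black triangle $b=\{p,q,r\}$ above the row; the elements of $U_b$ vanishing at $r$ define an isomorphism $W_p\to W_q$, and the holonomy along $\gamma$ of the resulting quaternionic connection on the row has complex eigenvalues $\mu_i,\bar\mu_i\in\mathbb{C}_*$ (the horizontal holonomies). (G): for every normalized adapted basis, $\mu_0,\bar\mu_0,\dots,\mu_{m-1},\bar\mu_{m-1}$ are mutually distinct. *)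

theory Defs
  imports "HOL-Analysis.Analysis"
begin

section \<open>Quaternions\<close>

datatype quat = Quat (qRe: real) (qI: real) (qJ: real) (qK: real)

instantiation quat :: division_ring
begin

definition "0 = Quat 0 0 0 0"
definition "1 = Quat 1 0 0 0"
definition "x + y = Quat (qRe x + qRe y) (qI x + qI y) (qJ x + qJ y) (qK x + qK y)"
definition "x - y = Quat (qRe x - qRe y) (qI x - qI y) (qJ x - qJ y) (qK x - qK y)"
definition "- x = Quat (- qRe x) (- qI x) (- qJ x) (- qK x)"
definition "x * y = Quat
  (qRe x * qRe y - qI x * qI y - qJ x * qJ y - qK x * qK y)
  (qRe x * qI y + qI x * qRe y + qJ x * qK y - qK x * qJ y)
  (qRe x * qJ y - qI x * qK y + qJ x * qRe y + qK x * qI y)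
  (qRe x * qK y + qI x * qJ y - qJ x * qI y + qK x * qRe y)"
definition "inverse x =
  (let n = (qRe x)\<^sup>2 + (qI x)\<^sup>2 + (qJ x)\<^sup>2 + (qK x)\<^sup>2
   in Quat (qRe x / n) (- qI x / n) (- qJ x / n) (- qK x / n))"
definition "x div y = x * inverse (y :: quat)"

lemmas quat_defs = zero_quat_def one_quat_def plus_quat_def minus_quat_def
  uminus_quat_def times_quat_def inverse_quat_def divide_quat_def

lemma quat_normsq_pos:
  assumes "x \<noteq> (0 :: quat)"
  shows "(qRe x)\<^sup>2 + (qI x)\<^sup>2 + (qJ x)\<^sup>2 + (qK x)\<^sup>2 > 0"
proof (rule ccontr)
  assume "\<not> ?thesis"
  then have "(qRe x)\<^sup>2 = 0 \<and> (qI x)\<^sup>2 = 0 \<and> (qJ x)\<^sup>2 = 0 \<and> (qK x)\<^sup>2 = 0"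
    by (smt (verit) zero_le_power2)
  with assms show False by (cases x) (simp add: zero_quat_def)
qed

instance
proof
  fix x y z :: quat
  show "x + y + z = x + (y + z)" "x + y = y + x" "0 + x = x" "- x + x = 0" "x - y = x + - y"
    "1 * x = x" "x * 1 = x" "(0::quat) \<noteq> 1" "inverse (0 :: quat) = 0"
    by (auto simp: quat_defs)
  show "x * y * z = x * (y * z)" "(x + y) * z = x * z + y * z" "x * (y + z) = x * y + x * z"
    by (simp_all add: quat_defs algebra_simps)
  show "x div y = x * inverse y" by (simp add: divide_quat_def)
  assume "x \<noteq> 0"
  then have n: "(qRe x)\<^sup>2 + (qI x)\<^sup>2 + (qJ x)\<^sup>2 + (qK x)\<^sup>2 \<noteq> 0"
    using quat_normsq_pos by fastforce
  define N where "N = (qRe x)\<^sup>2 + (qI x)\<^sup>2 + (qJ x)\<^sup>2 + (qK x)\<^sup>2"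
  have N: "N \<noteq> 0" "qRe x * qRe x + qI x * qI x + qJ x * qJ x + qK x * qK x = N"
    using n by (simp_all add: N_def power2_eq_square)
  have inv: "inverse x = Quat (qRe x / N) (- qI x / N) (- qJ x / N) (- qK x / N)"
    by (simp add: inverse_quat_def Let_def N_def)
  show "inverse x * x = 1"
    using N by (simp add: inv times_quat_def one_quat_def field_simps)
  show "x * inverse x = 1"
    using N by (simp add: inv times_quat_def one_quat_def field_simps)
qed

end

definition quat_of_complex :: "complex \<Rightarrow> quat" where
  "quat_of_complex z = Quat (Re z) (Im z) 0 0"


section \<open>Right quaternionic vector spaces\<close>

text \<open>The library's modules have commutative scalars and act from the left, so the
  one- and two-dimensional right spaces needed here are set up directly.\<close>

record 'w qspace =
  qcarrier :: "'w set"
  qadd :: "'w \<Rightarrow> 'w \<Rightarrow> 'w"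
  qzero :: "'w"
  qscale :: "'w \<Rightarrow> quat \<Rightarrow> 'w"

definition right_qspace :: "'w qspace \<Rightarrow> bool" where
  "right_qspace E \<longleftrightarrow>
     qzero E \<in> qcarrier E \<and>
     (\<forall>x\<in>qcarrier E. \<forall>y\<in>qcarrier E. qadd E x y \<in> qcarrier E \<and> qadd E x y = qadd E y x) \<and>
     (\<forall>x\<in>qcarrier E. \<forall>y\<in>qcarrier E. \<forall>z\<in>qcarrier E.
        qadd E (qadd E x y) z = qadd E x (qadd E y z)) \<and>
     (\<forall>x\<in>qcarrier E. qadd E (qzero E) x = x \<and> (\<exists>y\<in>qcarrier E. qadd E y x = qzero E)) \<and>
     (\<forall>x\<in>qcarrier E. \<forall>a. qscale E x a \<in> qcarrier E) \<and>
     (\<forall>x\<in>qcarrier E. qscale E x 1 = x) \<and>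
     (\<forall>x\<in>qcarrier E. \<forall>a b. qscale E (qscale E x a) b = qscale E x (a * b)) \<and>
     (\<forall>x\<in>qcarrier E. \<forall>a b. qscale E x (a + b) = qadd E (qscale E x a) (qscale E x b)) \<and>
     (\<forall>x\<in>qcarrier E. \<forall>y\<in>qcarrier E. \<forall>a.
        qscale E (qadd E x y) a = qadd E (qscale E x a) (qscale E y a))"

definition qdim1 :: "'w qspace \<Rightarrow> bool" where
  "qdim1 E \<longleftrightarrow> (\<exists>e\<in>qcarrier E. \<forall>x\<in>qcarrier E. \<exists>!a. x = qscale E e a)"

definition qdim2 :: "'w qspace \<Rightarrow> bool" where
  "qdim2 E \<longleftrightarrow> (\<exists>e\<in>qcarrier E. \<exists>e'\<in>qcarrier E.
     \<forall>x\<in>qcarrier E. \<exists>!(a, b). x = qadd E (qscale E e a) (qscale E e' b))"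

definition product_qspace :: "'i set \<Rightarrow> ('i \<Rightarrow> 'w qspace) \<Rightarrow> ('i \<Rightarrow> 'w) qspace" where
  "product_qspace I E =
     \<lparr> qcarrier = (\<Pi>\<^sub>E i\<in>I. qcarrier (E i)),
       qadd = (\<lambda>u v. \<lambda>i\<in>I. qadd (E i) (u i) (v i)),
       qzero = (\<lambda>i\<in>I. qzero (E i)),
       qscale = (\<lambda>u a. \<lambda>i\<in>I. qscale (E i) (u i) a) \<rparr>"


section \<open>The black and white triangulation of the plane and its dual\<close>

text \<open>
  The vertex \<open>(a, b)\<close> stands for the point \<open>a + b \<omega>\<close> of the complex plane, \<open>\<omega> = exp (\<i> \<pi> / 3)\<close>.
  \<open>Black p\<close> is the triangle \<open>p, p + 1, p + \<omega>\<close> and \<open>White p\<close> the triangle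
  \<open>p + 1, p + \<omega>, p + 1 + \<omega>\<close>.
\<close>

type_synonym vertex = "int \<times> int"

datatype black = Black vertex
datatype white = White vertex

fun black_corners :: "black \<Rightarrow> vertex set" where
  "black_corners (Black (a, b)) = {(a, b), (a + 1, b), (a, b + 1)}"

fun white_corners :: "white \<Rightarrow> vertex set" where
  "white_corners (White (a, b)) = {(a + 1, b), (a, b + 1), (a + 1, b + 1)}"

text \<open>The black triangles sharing an edge with a white one.\<close>

definition adjacent_blacks :: "white \<Rightarrow> black set" where
  "adjacent_blacks w = {b. card (black_corners b \<inter> white_corners w) = 2}"

text \<open>
  A black and white coloured surface with regular combinatorics enters through its universal
  covering: the vertices \<open>'v\<close>, the black faces \<open>'b\<close>, their corners, and the action of the
  translations of the plane on both.  Objects on a quotient by a lattice \<open>\<Gamma>\<close> are the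
  \<open>\<Gamma>\<close>-invariant objects on the covering.
\<close>

record ('v, 'b) bw_cover =
  vshift :: "vertex \<Rightarrow> 'v \<Rightarrow> 'v"
  bshift :: "vertex \<Rightarrow> 'b \<Rightarrow> 'b"
  corners :: "'b \<Rightarrow> 'v set"

primrec shift_black :: "vertex \<Rightarrow> black \<Rightarrow> black" where
  "shift_black g (Black p) = Black (g + p)"

primrec shift_white :: "vertex \<Rightarrow> white \<Rightarrow> white" where
  "shift_white g (White p) = White (g + p)"

definition M_cover :: "(vertex, black) bw_cover" where
  "M_cover = \<lparr> vshift = (+), bshift = shift_black, corners = black_corners \<rparr>"

text \<open>The covering of \<open>M'\<close>: its vertices are the black triangles of \<open>M\<close>, its black faces the
  white triangles of \<open>M\<close>.\<close>

definition M'_cover :: "(black, white) bw_cover" where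
  "M'_cover = \<lparr> vshift = shift_black, bshift = shift_white, corners = adjacent_blacks \<rparr>"

text \<open>Every edge is an edge of exactly one black face.\<close>

definition adjacent :: "('v, 'b) bw_cover \<Rightarrow> 'v \<Rightarrow> 'v \<Rightarrow> bool" where
  "adjacent T p q \<longleftrightarrow> p \<noteq> q \<and> (\<exists>b. p \<in> corners T b \<and> q \<in> corners T b)"

definition ismult :: "int \<Rightarrow> vertex \<Rightarrow> vertex" where
  "ismult n p = (n * fst p, n * snd p)"

text \<open>A positive multiple of the oriented area form of the plane.\<close>

definition det2 :: "vertex \<Rightarrow> vertex \<Rightarrow> int" where
  "det2 p q = fst p * snd q - snd p * fst q"

definition lattice_basis :: "vertex set \<Rightarrow> vertex \<Rightarrow> vertex \<Rightarrow> bool" where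
  "lattice_basis \<Gamma> \<gamma> \<eta> \<longleftrightarrow>
     det2 \<gamma> \<eta> \<noteq> 0 \<and> \<Gamma> = {ismult m \<gamma> + ismult n \<eta> | m n. True}"

text \<open>The second and third conditions say that the cell decomposition of the quotient is regular;
  a triangle with three distinct vertices has three distinct edges.\<close>

definition discrete_torus :: "vertex set \<Rightarrow> bool" where
  "discrete_torus \<Gamma> \<longleftrightarrow>
     (\<exists>\<gamma> \<eta>. lattice_basis \<Gamma> \<gamma> \<eta>) \<and>
     (\<forall>b. \<forall>p\<in>black_corners b. \<forall>q\<in>black_corners b. p - q \<in> \<Gamma> \<longrightarrow> p = q) \<and>
     (\<forall>w. \<forall>p\<in>white_corners w. \<forall>q\<in>white_corners w. p - q \<in> \<Gamma> \<longrightarrow> p = q)"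


section \<open>Holomorphic line bundles and their spectrum\<close>

record ('v, 'b, 'w) hbundle =
  fibre :: "'v \<Rightarrow> 'w qspace"
  hol :: "'b \<Rightarrow> ('v \<Rightarrow> 'w) set"

definition holomorphic_line_bundle ::
  "vertex set \<Rightarrow> ('v, 'b) bw_cover \<Rightarrow> ('v, 'b, 'w) hbundle \<Rightarrow> bool" where
  "holomorphic_line_bundle \<Gamma> T W \<longleftrightarrow>
     (\<forall>p. right_qspace (fibre W p) \<and> qdim1 (fibre W p)) \<and>
     (\<forall>g\<in>\<Gamma>. \<forall>p. fibre W (vshift T g p) = fibre W p) \<and>
     (\<forall>b. let P = product_qspace (corners T b) (fibre W) in
        hol W b \<subseteq> qcarrier P \<and>
        right_qspace (P\<lparr>qcarrier := hol W b\<rparr>) \<and> qdim2 (P\<lparr>qcarrier := hol W b\<rparr>)) \<and>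
     (\<forall>g\<in>\<Gamma>. \<forall>b. hol W b =
        {\<lambda>p\<in>corners T b. u (vshift T g p) | u. u \<in> hol W (bshift T g b)}) \<and>
     (\<forall>b. \<forall>u\<in>hol W b. \<forall>p\<in>corners T b. \<forall>q\<in>corners T b.
        p \<noteq> q \<and> u p = qzero (fibre W p) \<and> u q = qzero (fibre W q) \<longrightarrow>
        (\<forall>r\<in>corners T b. u r = qzero (fibre W r)))"

definition holomorphic_section ::
  "('v, 'b) bw_cover \<Rightarrow> ('v, 'b, 'w) hbundle \<Rightarrow> ('v \<Rightarrow> 'w) \<Rightarrow> bool" where
  "holomorphic_section T W \<psi> \<longleftrightarrow>
     (\<forall>p. \<psi> p \<in> qcarrier (fibre W p)) \<and> (\<forall>b. restrict \<psi> (corners T b) \<in> hol W b)"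

text \<open>\<open>Hom(\<Gamma>, \<complex>\<^sub>*)\<close> as a set of functions with the junk value \<open>undefined\<close> outside \<open>\<Gamma>\<close>.\<close>

definition Hom :: "vertex set \<Rightarrow> (vertex \<Rightarrow> complex) set" where
  "Hom \<Gamma> = {h \<in> extensional \<Gamma>.
     (\<forall>g\<in>\<Gamma>. h g \<noteq> 0) \<and> (\<forall>g\<in>\<Gamma>. \<forall>g'\<in>\<Gamma>. h (g + g') = h g * h g')}"

definition Spec ::
  "vertex set \<Rightarrow> ('v, 'b) bw_cover \<Rightarrow> ('v, 'b, 'w) hbundle \<Rightarrow> (vertex \<Rightarrow> complex) set" where
  "Spec \<Gamma> T W = {h \<in> Hom \<Gamma>. \<exists>\<psi>. holomorphic_section T W \<psi> \<and>
     (\<forall>g\<in>\<Gamma>. \<forall>p. \<psi> (vshift T g p) = qscale (fibre W p) (\<psi> p) (quat_of_complex (h g))) \<and>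
     (\<exists>p. \<psi> p \<noteq> qzero (fibre W p))}"


section \<open>Immersions and Darboux transforms\<close>

type_synonym quat2 = "quat \<times> quat"

definition rscale :: "quat2 \<Rightarrow> quat \<Rightarrow> quat2" where
  "rscale x a = (fst x * a, snd x * a)"

text \<open>The points of the quaternionic projective line.\<close>

definition HP1 :: "quat2 set set" where
  "HP1 = {range (rscale x) | x. x \<noteq> 0}"

definition immersion :: "vertex set \<Rightarrow> ('v, 'b) bw_cover \<Rightarrow> ('v \<Rightarrow> quat2 set) \<Rightarrow> bool" where
  "immersion \<Gamma> T L \<longleftrightarrow>
     (\<forall>p. L p \<in> HP1) \<and>
     (\<forall>g\<in>\<Gamma>. \<forall>p. L (vshift T g p) = L p) \<and>
     (\<forall>p q. adjacent T p q \<longrightarrow> L p \<noteq> L q)"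

definition coset :: "quat2 set \<Rightarrow> quat2 \<Rightarrow> quat2 set" where
  "coset K x = (\<lambda>l. x + l) ` K"

definition quotient_qspace :: "quat2 set \<Rightarrow> quat2 set qspace" where
  "quotient_qspace K =
     \<lparr> qcarrier = range (coset K),
       qadd = (\<lambda>A B. {a + b | a b. a \<in> A \<and> b \<in> B}),
       qzero = K,
       qscale = (\<lambda>A c. {rscale a c + l | a l. a \<in> A \<and> l \<in> K}) \<rparr>"

text \<open>The bundle \<open>V/L\<close>.\<close>

definition quotient_bundle ::
  "('v, 'b) bw_cover \<Rightarrow> ('v \<Rightarrow> quat2 set) \<Rightarrow> ('v, 'b, quat2 set) hbundle" where
  "quotient_bundle T L =
     \<lparr> fibre = (\<lambda>p. quotient_qspace (L p)),
       hol = (\<lambda>b. range (\<lambda>x. \<lambda>p\<in>corners T b. coset (L p) x)) \<rparr>"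

lemma adjacent_blacks_eq:
  "adjacent_blacks (White (a, b)) = {Black (a, b), Black (a + 1, b), Black (a, b + 1)}"
proof -
  have "B \<in> adjacent_blacks (White (a, b)) \<longleftrightarrow> B \<in> {Black (a, b), Black (a + 1, b), Black (a, b + 1)}" for B
  proof (cases B)
    case (Black p)
    obtain c d where "p = (c, d)" by fastforce
    with Black show ?thesis
      by (auto simp: adjacent_blacks_def Int_insert_left card_insert_if split: if_splits)
  qed
  then show ?thesis by blast
qed

lemma card_corners: "card (corners M_cover b) = 3" "card (corners M'_cover w) = 3"
proof -
  show "card (corners M_cover b) = 3"
    by (cases b rule: black_corners.cases) (simp add: M_cover_def)
  show "card (corners M'_cover w) = 3"
    by (cases w rule: white_corners.cases) (simp add: M'_cover_def adjacent_blacks_eq)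
qed

lemma rscale_simps:
  "rscale (rscale x a) b = rscale x (a * b)" "rscale x (a + b) = rscale x a + rscale x b"
  "rscale (x + y) a = rscale x a + rscale y a" "rscale x 1 = x" "rscale x 0 = 0" "rscale 0 a = 0"
  "rscale (- x) a = - rscale x a" "rscale (x - y) a = rscale x a - rscale y a" "rscale x (- a) = - rscale x a"
  by (auto simp: rscale_def algebra_simps prod_eq_iff)

lemma HP1_closed:
  assumes "K \<in> HP1"
  shows "0 \<in> K" "x \<in> K \<Longrightarrow> y \<in> K \<Longrightarrow> x + y \<in> K" "x \<in> K \<Longrightarrow> - x \<in> K" "x \<in> K \<Longrightarrow> rscale x a \<in> K"
    "x \<in> K \<Longrightarrow> y \<in> K \<Longrightarrow> x - y \<in> K"
proof -
  from assms obtain k where K: "K = range (rscale k)" by (auto simp: HP1_def)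
  show 1: "0 \<in> K" unfolding K by (metis rscale_simps(5) rangeI)
  show 2: "x \<in> K \<Longrightarrow> y \<in> K \<Longrightarrow> x + y \<in> K" for x y
    unfolding K by (auto simp flip: rscale_simps(2))
  show 3: "x \<in> K \<Longrightarrow> - x \<in> K" for x
    unfolding K by (auto simp flip: rscale_simps(9))
  show "x \<in> K \<Longrightarrow> rscale x a \<in> K"
    unfolding K by (auto simp: rscale_simps(1))
  show "x \<in> K \<Longrightarrow> y \<in> K \<Longrightarrow> x - y \<in> K" using 2[of x "- y"] 3[of y] by simp
qed

lemma coset_iff:
  assumes "K \<in> HP1" shows "y \<in> coset K x \<longleftrightarrow> y - x \<in> K"
proof
  assume "y \<in> coset K x" then show "y - x \<in> K" by (auto simp: coset_def)
next
  assume "y - x \<in> K" then have "x + (y - x) \<in> coset K x" unfolding coset_def by blast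
  then show "y \<in> coset K x" by simp
qed

lemma coset_eq:
  assumes "K \<in> HP1" shows "coset K x = coset K y \<longleftrightarrow> x - y \<in> K"
proof
  assume "coset K x = coset K y" then show "x - y \<in> K"
    using coset_iff[OF assms, of x x] coset_iff[OF assms, of x y] HP1_closed(1)[OF assms] by simp
next
  assume a: "x - y \<in> K"
  have "z - x \<in> K \<longleftrightarrow> z - y \<in> K" for z
    using HP1_closed(2)[OF assms, of "z - x" "x - y"] HP1_closed(5)[OF assms, of "z - y" "x - y"] a by auto
  then show "coset K x = coset K y" by (auto simp: coset_iff[OF assms])
qed

lemma HP1_eqI:
  assumes "K \<in> HP1" "K' \<in> HP1" "x \<in> K" "x \<in> K'" "x \<noteq> 0"
  shows "K = K'"
proof -
  have *: "J = range (rscale x)" if J: "J \<in> HP1" and x: "x \<in> J" for J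
  proof -
    from J x obtain k a where k: "J = range (rscale k)" and a: "x = rscale k a" by (auto simp: HP1_def)
    have "a \<noteq> 0" using assms(5) a by (auto simp: rscale_simps)
    have "rscale k c = rscale x (inverse a * c)" for c
      using \<open>a \<noteq> 0\<close> by (simp add: a rscale_simps flip: mult.assoc)
    then have "range (rscale k) \<subseteq> range (rscale x)" by blast
    moreover have "range (rscale x) \<subseteq> range (rscale k)" using a by (auto simp: rscale_simps)
    ultimately show ?thesis unfolding k by blast
  qed
  show ?thesis using * assms by blast
qed

lemma qspace_simps:
  assumes "K \<in> HP1"
  shows "qadd (quotient_qspace K) (coset K x) (coset K y) = coset K (x + y)"
    and "qscale (quotient_qspace K) (coset K x) a = coset K (rscale x a)"
    and "qzero (quotient_qspace K) = coset K 0"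
    and "qcarrier (quotient_qspace K) = range (coset K)"
proof -
  note c = HP1_closed[OF assms] and i = coset_iff[OF assms]
  have "z \<in> {u + v |u v. u \<in> coset K x \<and> v \<in> coset K y} \<longleftrightarrow> z - (x + y) \<in> K" for z
  proof
    assume "z \<in> {u + v |u v. u \<in> coset K x \<and> v \<in> coset K y}"
    then obtain u v where "z = u + v" "u - x \<in> K" "v - y \<in> K" by (auto simp: i)
    then show "z - (x + y) \<in> K" using c(2)[of "u - x" "v - y"] by (simp add: algebra_simps)
  next
    assume "z - (x + y) \<in> K"
    then have "x \<in> coset K x" "z - x \<in> coset K y" "z = x + (z - x)" using c(1) by (auto simp: i algebra_simps)
    then show "z \<in> {u + v |u v. u \<in> coset K x \<and> v \<in> coset K y}" by blast
  qed
  then show "qadd (quotient_qspace K) (coset K x) (coset K y) = coset K (x + y)"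
    by (auto simp: quotient_qspace_def i)
  have "z \<in> {rscale u a + l |u l. u \<in> coset K x \<and> l \<in> K} \<longleftrightarrow> z - rscale x a \<in> K" for z
  proof
    assume "z \<in> {rscale u a + l |u l. u \<in> coset K x \<and> l \<in> K}"
    then obtain u l where "z = rscale u a + l" "u - x \<in> K" "l \<in> K" by (auto simp: i)
    then show "z - rscale x a \<in> K" using c(2)[OF c(4)[of "u - x" a], of l] by (simp add: rscale_simps algebra_simps)
  next
    assume "z - rscale x a \<in> K"
    then have "x \<in> coset K x" "z - rscale x a \<in> K" "z = rscale x a + (z - rscale x a)" using c(1) by (auto simp: i)
    then show "z \<in> {rscale u a + l |u l. u \<in> coset K x \<and> l \<in> K}" by blast
  qed
  then show "qscale (quotient_qspace K) (coset K x) a = coset K (rscale x a)"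
    by (auto simp: quotient_qspace_def i)
  show "qzero (quotient_qspace K) = coset K 0" by (auto simp: quotient_qspace_def coset_def)
  show "qcarrier (quotient_qspace K) = range (coset K)" by (simp add: quotient_qspace_def)
qed

lemma quotient_qspace: "right_qspace (quotient_qspace K)" "qdim1 (quotient_qspace K)" if K: "K \<in> HP1"
proof -
  show "right_qspace (quotient_qspace K)"
  proof -
    have "\<exists>y. coset K (y + x) = coset K 0" for x by (metis add.left_inverse)
    then show ?thesis
      unfolding right_qspace_def qspace_simps(3,4)[OF K]
      by (simp add: qspace_simps[OF K] rscale_simps add_ac del: split_paired_All)
  qed
  obtain k where k: "K = range (rscale k)" "k \<noteq> 0" using K by (auto simp: HP1_def)
  have kK: "k \<in> K" unfolding k by (metis rangeI rscale_simps(4))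
  obtain e where e: "e \<notin> K" "\<And>x. \<exists>a. x - rscale e a \<in> K"
  proof (cases "fst k = 0")
    case True
    then have s: "snd k \<noteq> 0" using k by (auto simp: prod_eq_iff)
    have "(1, 0) \<notin> K" unfolding k using True by (auto simp: rscale_def)
    moreover have "\<exists>a. x - rscale (1, 0) a \<in> K" for x
    proof -
      have "x - rscale (1, 0) (fst x) = rscale k (inverse (snd k) * snd x)"
        using s True by (simp add: rscale_def prod_eq_iff flip: mult.assoc)
      then show ?thesis unfolding k by blast
    qed
    ultimately show ?thesis using that by blast
  next
    case False
    have "(0, 1) \<notin> K" unfolding k using False by (auto simp: rscale_def prod_eq_iff)
    moreover have "\<exists>a. x - rscale (0, 1) a \<in> K" for x
    proof -
      have "x - rscale (0, 1) (snd x - snd k * inverse (fst k) * fst x) = rscale k (inverse (fst k) * fst x)"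
        using False by (simp add: rscale_def prod_eq_iff mult.assoc) (simp flip: mult.assoc add: False)
      then show ?thesis unfolding k by blast
    qed
    ultimately show ?thesis using that by blast
  qed
  have uniq: "a = b" if "rscale e (a - b) \<in> K" for a b
  proof (rule ccontr)
    assume "a \<noteq> b"
    then have "rscale (rscale e (a - b)) (inverse (a - b)) = e" by (simp add: rscale_simps)
    with HP1_closed(4)[OF K that] e show False by metis
  qed
  have "\<exists>!a. coset K x = coset K (rscale e a)" for x
  proof -
    obtain a where a: "x - rscale e a \<in> K" using e by blast
    have "b = a" if "x - rscale e b \<in> K" for b
    proof -
      have "rscale e (b - a) = (x - rscale e a) - (x - rscale e b)"
        by (simp add: rscale_def prod_eq_iff algebra_simps)
      then show ?thesis using uniq HP1_closed(5)[OF K a that] by simp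
    qed
    with a show ?thesis by (auto simp: coset_eq[OF K])
  qed
  then show "qdim1 (quotient_qspace K)"
    unfolding qdim1_def qspace_simps(4)[OF K]
    by (intro bexI[of _ "coset K e"]) (auto simp: qspace_simps[OF K] simp del: split_paired_All)
qed

lemma holomorphic_line_bundle_quotient:
  assumes imm: "immersion \<Gamma> T L"
    and card: "\<And>b. card (corners T b) = 3"
    and equiv: "\<And>g b. corners T (bshift T g b) = vshift T g ` corners T b"
  shows "holomorphic_line_bundle \<Gamma> T (quotient_bundle T L)"
proof -
  have L: "L p \<in> HP1" "g \<in> \<Gamma> \<Longrightarrow> L (vshift T g p) = L p" for p g
    using imm by (auto simp: immersion_def)
  have neq: "L p \<noteq> L q" if "p \<in> corners T b" "q \<in> corners T b" "p \<noteq> q" for p q b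
    using imm that unfolding immersion_def adjacent_def by metis
  have eq0: "x = y" if "p \<in> corners T b" "q \<in> corners T b" "p \<noteq> q" "x - y \<in> L p" "x - y \<in> L q" for x y :: quat2 and p q b
    using HP1_eqI[OF L(1) L(1) that(4,5)] neq[OF that(1-3)] by auto
  have ev: "(\<lambda>p\<in>C. coset (L p) x) = (\<lambda>p\<in>C. coset (L p) y) \<longleftrightarrow> x = y" if C: "C = corners T b" for x y C b
  proof
    assume a: "(\<lambda>p\<in>C. coset (L p) x) = (\<lambda>p\<in>C. coset (L p) y)"
    obtain p q where "p \<in> C" "q \<in> C" "p \<noteq> q"
      using card[of b] C by (metis card_3_iff insertCI)
    then show "x = y"
      using eq0[of p b q x y] fun_cong[OF a, of p] fun_cong[OF a, of q] C by (auto simp: coset_eq[OF L(1)])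
  qed simp
  show ?thesis
    unfolding holomorphic_line_bundle_def Let_def
  proof (intro conjI allI ballI impI)
    fix p show "right_qspace (fibre (quotient_bundle T L) p)" "qdim1 (fibre (quotient_bundle T L) p)"
      using quotient_qspace[OF L(1)] by (simp_all add: quotient_bundle_def)
  next
    fix g p assume "g \<in> \<Gamma>" then show "fibre (quotient_bundle T L) (vshift T g p) = fibre (quotient_bundle T L) p"
      by (simp add: quotient_bundle_def L)
  next
    fix b
    let ?C = "corners T b"
    let ?P = "product_qspace ?C (fibre (quotient_bundle T L))"
    let ?Q = "?P\<lparr>qcarrier := hol (quotient_bundle T L) b\<rparr>"
    define E where "E x = (\<lambda>p\<in>?C. coset (L p) x)" for x
    show "hol (quotient_bundle T L) b \<subseteq> qcarrier ?P"
      by (auto simp: quotient_bundle_def product_qspace_def qspace_simps[OF L(1)])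
    have sim: "qcarrier ?Q = range E" "qadd ?Q (E x) (E y) = E (x + y)" "qscale ?Q (E x) a = E (rscale x a)"
      "qzero ?Q = E 0" "E x = E y \<longleftrightarrow> x = y" for x y a
      using ev[of "corners T b" b x y]
      by (auto simp: quotient_bundle_def product_qspace_def E_def qspace_simps[OF L(1)] cong: restrict_cong)
    have add: "qadd ?P (E x) (E y) = E (x + y)" "qscale ?P (E x) a = E (rscale x a)" "qzero ?P = E 0" for x y a
      using sim(2-4) by simp_all
    have "\<exists>y. y + x = 0" for x :: quat2 by (metis add.left_inverse)
    then show "right_qspace ?Q"
      unfolding right_qspace_def sim(1,4)
      by (simp add: add sim(5) rscale_simps add_ac del: split_paired_All split_paired_Ex)
    show "qdim2 ?Q"
      unfolding qdim2_def sim(1)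
      by (rule bexI[of _ "E (1, 0)"], rule bexI[of _ "E (0, 1)"])
         (auto simp: add sim(5) rscale_def prod_eq_iff)
  next
    fix g b assume "g \<in> \<Gamma>"
    have eq: "(\<lambda>p\<in>corners T b. restrict (\<lambda>p. coset (L p) x) (corners T (bshift T g b)) (vshift T g p))
      = (\<lambda>p\<in>corners T b. coset (L p) x)" for x
      using \<open>g \<in> \<Gamma>\<close> by (auto simp: equiv L cong: restrict_cong)
    have rg: "range G = {R u |u. u \<in> range F}" if "\<And>x. R (F x) = G x"
      for F :: "quat2 \<Rightarrow> 'a \<Rightarrow> quat2 set" and G R by (simp add: Setcompr_eq_image image_image that del: split_paired_All split_paired_Ex)
    show "hol (quotient_bundle T L) b = {\<lambda>p\<in>corners T b. u (vshift T g p) |u. u \<in> hol (quotient_bundle T L) (bshift T g b)}"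
      unfolding quotient_bundle_def hbundle.simps by (rule rg) (rule eq)
  next
    fix b u p q r
    assume u: "u \<in> hol (quotient_bundle T L) b" and pq: "p \<in> corners T b" "q \<in> corners T b" and r: "r \<in> corners T b"
      and z: "p \<noteq> q \<and> u p = qzero (fibre (quotient_bundle T L) p) \<and> u q = qzero (fibre (quotient_bundle T L) q)"
    from u obtain x where x: "u = (\<lambda>p\<in>corners T b. coset (L p) x)" by (auto simp: quotient_bundle_def)
    have "x = 0" using z pq eq0[OF pq, of x 0]
      by (auto simp: x quotient_bundle_def qspace_simps[OF L(1)] coset_eq[OF L(1)])
    then show "u r = qzero (fibre (quotient_bundle T L) r)"
      using r by (simp add: x quotient_bundle_def qspace_simps[OF L(1)])
  qed
qed

lemma corners_bshift:
  "corners M_cover (bshift M_cover g b) = vshift M_cover g ` corners M_cover b"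
  "corners M'_cover (bshift M'_cover g w) = vshift M'_cover g ` corners M'_cover w"
proof -
  obtain m n where g: "g = (m, n)" by fastforce
  show "corners M_cover (bshift M_cover g b) = vshift M_cover g ` corners M_cover b"
    by (cases b rule: black_corners.cases) (simp add: M_cover_def g add.assoc)
  show "corners M'_cover (bshift M'_cover g w) = vshift M'_cover g ` corners M'_cover w"
    by (cases w rule: white_corners.cases) (simp add: M'_cover_def g adjacent_blacks_eq add.assoc)
qed

lemma holomorphic_line_bundle_V_mod_L:
  "immersion \<Gamma> M_cover L \<Longrightarrow> holomorphic_line_bundle \<Gamma> M_cover (quotient_bundle M_cover L)"
  "immersion \<Gamma> M'_cover L' \<Longrightarrow> holomorphic_line_bundle \<Gamma> M'_cover (quotient_bundle M'_cover L')"
  by (rule holomorphic_line_bundle_quotient; simp add: card_corners corners_bshift)+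


text \<open>
  The edges of \<open>M'\<close> are the pairs \<open>(w, v)\<close> with \<open>v\<close> a corner of \<open>w\<close>; its faces, given here by
  their boundary edges, correspond to the white triangles and to the vertices of \<open>M\<close>.
\<close>

definition edge_ends :: "white \<times> vertex \<Rightarrow> black set" where
  "edge_ends e = {b \<in> adjacent_blacks (fst e). snd e \<in> black_corners b}"

definition M'_faces :: "(white \<times> vertex) set set" where
  "M'_faces =
     {{(w, v) | v. v \<in> white_corners w} | w. True} \<union>
     {{(w, v) | w. v \<in> white_corners w} | v. True}"

text \<open>The isomorphism \<open>L\<^sup>#\<^sub>b \<rightarrow> \<H>\<^sup>2/L\<^sub>v \<rightarrow> L\<^sup>#\<^sub>b\<^sub>'\<close> as a relation.\<close>

definition darboux_transport ::
  "(vertex \<Rightarrow> quat2 set) \<Rightarrow> (black \<Rightarrow> quat2 set) \<Rightarrow> vertex \<Rightarrow> black \<Rightarrow> black \<Rightarrow> (quat2 \<times> quat2) set" where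
  "darboux_transport L L' v b b' = {(x, y). x \<in> L' b \<and> y \<in> L' b' \<and> coset (L v) x = coset (L v) y}"

definition darboux_transform ::
  "vertex set \<Rightarrow> (vertex \<Rightarrow> quat2 set) \<Rightarrow> (black \<Rightarrow> quat2 set) \<Rightarrow> bool" where
  "darboux_transform \<Gamma> L L' \<longleftrightarrow>
     (\<forall>b. L' b \<in> HP1) \<and>
     (\<forall>g\<in>\<Gamma>. \<forall>b. L' (shift_black g b) = L' b) \<and>
     (\<forall>b. \<forall>v\<in>black_corners b. L' b \<noteq> L v) \<and>
     (\<forall>F\<in>M'_faces. \<forall>e1\<in>F. \<forall>e2\<in>F. \<forall>e3\<in>F. \<forall>b1 b2 b3.
        distinct [e1, e2, e3] \<and> distinct [b1, b2, b3] \<and>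
        edge_ends e1 = {b1, b2} \<and> edge_ends e2 = {b2, b3} \<and> edge_ends e3 = {b3, b1} \<longrightarrow>
        darboux_transport L L' (snd e1) b1 b2 O darboux_transport L L' (snd e2) b2 b3
          O darboux_transport L L' (snd e3) b3 b1 = Id_on (L' b1))"


section \<open>Horizontal holonomies and the genericity assumption\<close>

definition plane_point :: "vertex \<Rightarrow> complex" where
  "plane_point p = of_int (fst p) + of_int (snd p) * cis (pi / 3)"

definition plane_angle :: "vertex \<Rightarrow> vertex \<Rightarrow> real" where
  "plane_angle p q = \<bar>Arg (plane_point q / plane_point p)\<bar>"

definition adapted_basis :: "vertex set \<Rightarrow> vertex \<Rightarrow> vertex \<Rightarrow> bool" where
  "adapted_basis \<Gamma> \<gamma> \<eta> \<longleftrightarrow>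
     lattice_basis \<Gamma> \<gamma> \<eta> \<and> det2 \<gamma> \<eta> > 0 \<and>
     (\<exists>e. adjacent M_cover 0 e \<and> det2 \<gamma> e = 0) \<and>
     (\<forall>b p q r. black_corners b = {p, q, r} \<and> distinct [p, q, r] \<and>
        det2 \<gamma> p = 0 \<and> det2 \<gamma> q = 0 \<longrightarrow> det2 \<gamma> r > 0)"

definition normalized_adapted_basis :: "vertex set \<Rightarrow> vertex \<Rightarrow> vertex \<Rightarrow> bool" where
  "normalized_adapted_basis \<Gamma> \<gamma> \<eta> \<longleftrightarrow>
     adapted_basis \<Gamma> \<gamma> \<eta> \<and> plane_angle \<gamma> \<eta> \<le> pi / 3 \<and> plane_angle \<gamma> (\<eta> - \<gamma>) > pi / 3"

text \<open>The isomorphism \<open>W\<^sub>p \<rightarrow> W\<^sub>q\<close> given by the elements of \<open>U\<^sub>b\<close> that vanish at the third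
  corner of the black triangle \<open>b\<close> with edge \<open>p q\<close>, as a relation.\<close>

definition edge_transport ::
  "(vertex, black, 'w) hbundle \<Rightarrow> vertex \<Rightarrow> vertex \<Rightarrow> ('w \<times> 'w) set" where
  "edge_transport W p q = {(u p, u q) | u b r.
     black_corners b = {p, q, r} \<and> distinct [p, q, r] \<and> u \<in> hol W b \<and> u r = qzero (fibre W r)}"

primrec row_transport ::
  "(vertex, black, 'w) hbundle \<Rightarrow> vertex \<Rightarrow> vertex \<Rightarrow> nat \<Rightarrow> ('w \<times> 'w) set" where
  "row_transport W p e 0 = Id_on (qcarrier (fibre W p))"
| "row_transport W p e (Suc n) =
     row_transport W p e n O edge_transport W (p + ismult (int n) e) (p + ismult (int (Suc n)) e)"

text \<open>A \<open>\<gamma>\<close> parallel to an edge direction is \<open>n e\<close> for a unique edge vector \<open>e\<close> and \<open>n > 0\<close>.\<close>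

definition horizontal_holonomy ::
  "(vertex, black, 'w) hbundle \<Rightarrow> vertex \<Rightarrow> vertex \<Rightarrow> ('w \<times> 'w) set" where
  "horizontal_holonomy W \<gamma> p = {xy. \<exists>e n. adjacent M_cover 0 e \<and> n > 0 \<and>
     \<gamma> = ismult (int n) e \<and> xy \<in> row_transport W p e n}"

definition horizontal_eigenvalues ::
  "(vertex, black, 'w) hbundle \<Rightarrow> vertex \<Rightarrow> vertex \<Rightarrow> complex set" where
  "horizontal_eigenvalues W \<gamma> p = {\<mu>. \<exists>x\<in>qcarrier (fibre W p). x \<noteq> qzero (fibre W p) \<and>
     (x, qscale (fibre W p) x (quat_of_complex \<mu>)) \<in> horizontal_holonomy W \<gamma> p}"

text \<open>The rows of vertices parallel to \<open>\<gamma>\<close> modulo \<open>\<Gamma>\<close>, each given by the set of all vertices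
  of its translates; their number is the thickness.\<close>

definition rows_mod :: "vertex set \<Rightarrow> vertex \<Rightarrow> vertex set set" where
  "rows_mod \<Gamma> \<gamma> = range (\<lambda>p. {q. \<exists>g\<in>\<Gamma>. det2 \<gamma> (q - (g + p)) = 0})"

text \<open>The last conjunct says that the numbers \<open>\<mu>\<^sub>R\<close> and \<open>cnj \<mu>\<^sub>R\<close>, for all rows \<open>R\<close>,
  are mutually distinct.\<close>

definition genericity :: "vertex set \<Rightarrow> (vertex, black, 'w) hbundle \<Rightarrow> bool" where
  "genericity \<Gamma> W \<longleftrightarrow> (\<forall>\<gamma> \<eta>. normalized_adapted_basis \<Gamma> \<gamma> \<eta> \<longrightarrow>
     (\<exists>\<mu>. (\<forall>R\<in>rows_mod \<Gamma> \<gamma>. \<forall>p\<in>R. horizontal_eigenvalues W \<gamma> p = {\<mu> R, cnj (\<mu> R)}) \<and>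
        inj_on (\<lambda>(R, c). if c then cnj (\<mu> R) else \<mu> R) (rows_mod \<Gamma> \<gamma> \<times> UNIV)))"


section \<open>The spectral curve\<close>

text \<open>Riemann surfaces are not assumed to be connected, since \<open>Spec\<close> may be reducible.\<close>

definition riemann_surface :: "'a topology \<Rightarrow> ('a set \<times> ('a \<Rightarrow> complex)) set \<Rightarrow> bool" where
  "riemann_surface X \<A> \<longleftrightarrow>
     Hausdorff_space X \<and> topspace X = \<Union> (fst ` \<A>) \<and>
     (\<forall>(U, \<phi>)\<in>\<A>. openin X U \<and> open (\<phi> ` U) \<and>
        homeomorphic_map (subtopology X U) (top_of_set (\<phi> ` U)) \<phi>) \<and>
     (\<forall>(U, \<phi>)\<in>\<A>. \<forall>(V, \<psi>)\<in>\<A>. (\<psi> \<circ> inv_into U \<phi>) holomorphic_on \<phi> ` (U \<inter> V))"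

text \<open>The topology of \<open>Hom(\<Gamma>, \<complex>\<^sub>*)\<close>, which a basis of \<open>\<Gamma>\<close> identifies with \<open>\<complex>\<^sub>*\<^sup>2\<close>.  A map into it is
  holomorphic iff all its components \<open>h\<^sub>\<gamma>\<close> are, and is an immersion at a point iff the
  derivative of one of them does not vanish there.\<close>

definition hom_topology :: "vertex set \<Rightarrow> (vertex \<Rightarrow> complex) topology" where
  "hom_topology \<Gamma> = subtopology (product_topology (\<lambda>_. euclidean) \<Gamma>) (Hom \<Gamma>)"

text \<open>The points at which \<open>S\<close> is a one-dimensional complex submanifold of \<open>Hom(\<Gamma>, \<complex>\<^sub>*)\<close>.\<close>

definition regular_points :: "vertex set \<Rightarrow> (vertex \<Rightarrow> complex) set \<Rightarrow> (vertex \<Rightarrow> complex) set" where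
  "regular_points \<Gamma> S = {s \<in> S. \<exists>N D \<phi>. openin (hom_topology \<Gamma>) N \<and> s \<in> N \<and> open D \<and>
     homeomorphic_map (top_of_set D) (subtopology (hom_topology \<Gamma>) (S \<inter> N)) \<phi> \<and>
     (\<forall>g\<in>\<Gamma>. (\<lambda>t. \<phi> t g) holomorphic_on D) \<and>
     (\<forall>t\<in>D. \<exists>g\<in>\<Gamma>. deriv (\<lambda>t. \<phi> t g) t \<noteq> 0)}"

text \<open>
  The normalization of a one-dimensional analytic set \<open>S\<close> in \<open>Hom(\<Gamma>, \<complex>\<^sub>*)\<close>: a Riemann surface
  with a finite (that is, proper with finite fibres) surjective holomorphic map \<open>h\<close> onto \<open>S\<close>
  that is biholomorphic (a bijective immersion) over the regular points, whose complement has
  nowhere dense preimage.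
\<close>

definition normalization ::
  "vertex set \<Rightarrow> (vertex \<Rightarrow> complex) set \<Rightarrow>
   'a topology \<Rightarrow> ('a set \<times> ('a \<Rightarrow> complex)) set \<Rightarrow> ('a \<Rightarrow> vertex \<Rightarrow> complex) \<Rightarrow> bool" where
  "normalization \<Gamma> S X \<A> h \<longleftrightarrow>
     riemann_surface X \<A> \<and>
     h ` topspace X = S \<and>
     continuous_map X (subtopology (hom_topology \<Gamma>) S) h \<and>
     (\<forall>(U, \<phi>)\<in>\<A>. \<forall>g\<in>\<Gamma>. (\<lambda>t. h (inv_into U \<phi> t) g) holomorphic_on \<phi> ` U) \<and>
     proper_map X (subtopology (hom_topology \<Gamma>) S) h \<and>
     (\<forall>s\<in>S. finite {x \<in> topspace X. h x = s}) \<and>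
     bij_betw h {x \<in> topspace X. h x \<in> regular_points \<Gamma> S} (regular_points \<Gamma> S) \<and>
     (\<forall>(U, \<phi>)\<in>\<A>. \<forall>x\<in>U. h x \<in> regular_points \<Gamma> S \<longrightarrow>
        (\<exists>g\<in>\<Gamma>. deriv (\<lambda>t. h (inv_into U \<phi> t) g) (\<phi> x) \<noteq> 0)) \<and>
     X interior_of (X closure_of {x \<in> topspace X. h x \<notin> regular_points \<Gamma> S}) = {}"

text \<open>The Riemann surface \<open>(X, \<A>)\<close> with the map \<open>h\<close> is the spectral curve of the immersion \<open>L\<close>.\<close>

definition is_spectral_curve ::
  "vertex set \<Rightarrow> ('v, 'b) bw_cover \<Rightarrow> ('v \<Rightarrow> quat2 set) \<Rightarrow>
   'a topology \<Rightarrow> ('a set \<times> ('a \<Rightarrow> complex)) set \<Rightarrow> ('a \<Rightarrow> vertex \<Rightarrow> complex) \<Rightarrow> bool" where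
  "is_spectral_curve \<Gamma> T L X \<A> h \<longleftrightarrow> normalization \<Gamma> (Spec \<Gamma> T (quotient_bundle T L)) X \<A> h"

end

theory Submission
  imports Defs "Jordan_Normal_Form.Determinant"
begin

text \<open>
  The spectral curve depends on an immersion only through the set of monodromies \<open>Spec\<close> of its
  quotient bundle, so the point is that \<open>f\<close> and \<open>f\<^sup>#\<close> have the same spectrum.

  A holomorphic section \<open>\<psi>\<close> of \<open>V/L\<close> has a unique prolongation: to each black triangle \<open>b\<close> it assigns
  the vector \<open>x\<^sub>b \<in> \<H>\<^sup>2\<close> that represents \<open>\<psi>\<^sub>v\<close> modulo \<open>L\<^sub>v\<close> at all three corners \<open>v\<close> of \<open>b\<close>.  With vertices
  and black triangles both indexed by \<open>\<int>\<^sup>2\<close> this describes the spectrum by means of the line field \<open>L\<close>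
  alone (\<open>monodromies\<close>), and it does so uniformly for \<open>M\<close> and \<open>M'\<close>, which have the same combinatorics.

  The spectrum does not shrink under a Darboux transform (\<open>monodromies_darboux_subset\<close>).  On a white
  triangle \<open>w\<close> the differences of \<open>x\<close> along the three edges lie in the lines \<open>L\<^sub>v\<close>, and so do those of a
  parallel section \<open>\<phi>\<close> of \<open>L\<^sup>#\<close>.  Both triples add up to zero, and three vectors in pairwise distinct
  lines of \<open>\<H>\<^sup>2\<close> that add up to zero are unique up to a common factor; hence \<open>x - \<phi> \<chi>\<close> has the same
  value \<open>y\<^sub>w\<close> on the three black triangles around \<open>w\<close>, for some \<open>\<chi> \<in> \<H>\<close>.  This \<open>y\<close> is the prolongation of
  a holomorphic section of \<open>V/L\<^sup>#\<close> with the same monodromy.  It vanishes only if \<open>x\<close> takes values in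
  \<open>L\<^sup>#\<close>, that is, if \<open>x\<close> is itself parallel.

  Both the exceptional case and the reverse inclusion are settled by duality (\<open>monodromies_dual\<close>):
  the line field \<open>L\<close> and its orthogonal complement on the torus with exchanged colours have the same
  spectrum.  Indeed, the prolongations with monodromy \<open>h\<close> form the kernel of a square linear system
  over the torus, and an element of its cokernel is a closed 1-form with values in \<open>L\<^sup>\<bottom>\<close>.  If \<open>h\<close> is not
  trivial the form integrates to a prolongation for \<open>L\<^sup>\<bottom>\<close>; constants take care of the trivial \<open>h\<close>.

  A parallel section \<open>x\<close> of \<open>L\<^sup>#\<close> has a dual parallel section \<open>\<beta>\<close> of \<open>L\<^sup>\<bottom>\<close>, normalized by
  \<open>\<langle>\<beta>\<^sub>v, x\<^sub>b\<rangle> = 1\<close> for \<open>v \<in> b\<close>, and \<open>\<beta>\<close> is the prolongation of a section for \<open>(L\<^sup>#)\<^sup>\<bottom>\<close>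
  (\<open>monodromies_dual_of_parallel\<close>).  The same duality turns the flatness of \<open>L\<^sup>#\<close>, a condition on the
  hexagon of lines around a white triangle, into the statement that \<open>L\<^sup>\<bottom>\<close> is a Darboux transform of
  \<open>(L\<^sup>#)\<^sup>\<bottom>\<close> (\<open>darboux_pair_dual\<close>), so the inclusion for this pair gives the reverse inclusion for \<open>L\<close>
  and \<open>L\<^sup>#\<close>.
\<close>

section \<open>Quaternions and the hermitian plane\<close>

definition qconj :: "quat \<Rightarrow> quat" where
  "qconj x = Quat (qRe x) (- qI x) (- qJ x) (- qK x)"

lemma qconj_simps [simp]:
  "qconj (x * y) = qconj y * qconj x" "qconj (x + y) = qconj x + qconj y"
  "qconj (x - y) = qconj x - qconj y" "qconj (- x) = - qconj x" "qconj (qconj x) = x"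
  "qconj 0 = 0" "qconj 1 = 1" "qconj x = 0 \<longleftrightarrow> x = 0"
  by (cases x; cases y; force simp: qconj_def quat_defs algebra_simps)+

lemma quat_of_complex_simps [simp]:
  "quat_of_complex (z * w) = quat_of_complex z * quat_of_complex w"
  "quat_of_complex 1 = 1"
  "quat_of_complex (cnj z) = qconj (quat_of_complex z)"
  "quat_of_complex z = quat_of_complex w \<longleftrightarrow> z = w"
  by (auto simp: quat_of_complex_def qconj_def quat_defs complex_eq_iff)

text \<open>
  Multiplication by \<open>j\<close> from the right exchanges a monodromy with its complex conjugate.  It is
  used to undo the conjugations that come from the hermitian form.
\<close>

definition quat_j :: quat where
  "quat_j = Quat 0 0 1 0"

lemma quat_j_nonzero: "quat_j \<noteq> 0"
  by (simp add: quat_j_def zero_quat_def)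

lemma qconj_complex_mult_j: "qconj (quat_of_complex z) * quat_j = quat_j * quat_of_complex z"
  by (simp add: quat_j_def quat_of_complex_def qconj_def times_quat_def)

lemma complex_quat_commute:
  "quat_of_complex z * quat_of_complex w = quat_of_complex w * quat_of_complex z"
  by (simp add: quat_of_complex_def times_quat_def)

text \<open>
  The real inner product is the one with \<open>qRe (qconj x * y)\<close>.  It is what turns real linear
  functionals on quaternionic data, which arise as cokernel elements, back into quaternionic data.
\<close>

instantiation quat :: euclidean_space
begin

definition "scaleR r x = Quat (r * qRe x) (r * qI x) (r * qJ x) (r * qK x)"
definition "inner x y = qRe x * qRe y + qI x * qI y + qJ x * qJ y + qK x * qK y"
definition "norm (x :: quat) = sqrt (inner x x)"
definition "dist (x :: quat) y = norm (x - y)"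
definition "sgn (x :: quat) = scaleR (inverse (norm x)) x"
definition "uniformity = (INF e\<in>{0<..}. principal {(x :: quat, y). dist x y < e})"
definition "open (U :: quat set) =
  (\<forall>x\<in>U. \<forall>\<^sub>F (x', y) in uniformity. x' = x \<longrightarrow> y \<in> U)"
definition "Basis = {Quat 1 0 0 0, Quat 0 1 0 0, Quat 0 0 1 0, Quat 0 0 0 1}"

instance
proof
  fix x y z :: quat and r s :: real
  note d = scaleR_quat_def inner_quat_def quat_defs algebra_simps
  show "r *\<^sub>R (x + y) = r *\<^sub>R x + r *\<^sub>R y" "(r + s) *\<^sub>R x = r *\<^sub>R x + s *\<^sub>R x"
    "r *\<^sub>R s *\<^sub>R x = (r * s) *\<^sub>R x" "1 *\<^sub>R x = x"
    by (simp_all add: d)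
  show "dist x y = norm (x - y)" by (rule dist_quat_def)
  show "sgn x = inverse (norm x) *\<^sub>R x" by (rule sgn_quat_def)
  show "uniformity = (INF e\<in>{0<..}. principal {(x :: quat, y). dist x y < e})"
    by (rule uniformity_quat_def)
  show "open U = (\<forall>x\<in>U. \<forall>\<^sub>F (x', y) in uniformity. x' = x \<longrightarrow> y \<in> U)"
    for U :: "quat set" by (rule open_quat_def)
  show "inner x y = inner y x" "inner (x + y) z = inner x z + inner y z"
    "inner (r *\<^sub>R x) y = r * inner x y"
    by (simp_all add: d)
  show "0 \<le> inner x x" by (simp add: inner_quat_def)
  show "inner x x = 0 \<longleftrightarrow> x = 0"
    by (cases x) (simp add: inner_quat_def zero_quat_def add_nonneg_eq_0_iff)
  show "norm x = sqrt (inner x x)" by (rule norm_quat_def)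
next
  show "(Basis :: quat set) \<noteq> {}" "finite (Basis :: quat set)"
    by (simp_all add: Basis_quat_def)
  show "inner u v = (if u = v then 1 else 0)" if "u \<in> Basis" "v \<in> Basis" for u v :: quat
    using that unfolding Basis_quat_def by (elim insertE emptyE; simp add: inner_quat_def)
  show "(\<forall>u\<in>Basis. inner x u = 0) \<longleftrightarrow> x = 0" for x :: quat
    by (cases x) (simp add: Basis_quat_def inner_quat_def zero_quat_def conj_assoc)
qed

end

lemma inner_mult_right_quat: "inner x (y * a) = inner (x * qconj a) (y :: quat)"
  by (simp add: inner_quat_def times_quat_def qconj_def algebra_simps)

lemma inner_mult_left_quat: "inner x (a * y) = inner (qconj a * x) (y :: quat)"
  by (simp add: inner_quat_def times_quat_def qconj_def algebra_simps)

definition herm :: "quat2 \<Rightarrow> quat2 \<Rightarrow> quat" where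
  "herm x y = qconj (fst x) * fst y + qconj (snd x) * snd y"

lemma herm_simps [simp]:
  "herm x (y + z) = herm x y + herm x z" "herm x (y - z) = herm x y - herm x z"
  "herm (x + y) z = herm x z + herm y z" "herm (x - y) z = herm x z - herm y z"
  "herm x (rscale y a) = herm x y * a" "herm (rscale x a) y = qconj a * herm x y"
  "herm x 0 = 0" "herm 0 x = 0"
  by (simp_all add: herm_def rscale_def algebra_simps)

lemma herm_commute: "herm y x = qconj (herm x y)"
  by (simp add: herm_def)

lemma inner_herm: "inner a (herm x y) = inner (rscale x a) y"
  by (simp add: herm_def rscale_def inner_prod_def inner_mult_left_quat inner_add_right)

lemma inner_rscale: "inner x (rscale y a) = inner (rscale x (qconj a)) y"
  by (simp add: rscale_def inner_prod_def inner_mult_right_quat)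

lemma rscale_scaleR [simp]:
  "rscale (r *\<^sub>R x) a = r *\<^sub>R rscale x a" "herm x (r *\<^sub>R y) = r *\<^sub>R herm x y"
  by (simp_all add: rscale_def herm_def prod_eq_iff scaleR_quat_def quat_defs algebra_simps)

lemma rscale_eq_0_iff: "rscale x a = 0 \<longleftrightarrow> x = 0 \<or> a = 0"
  by (auto simp: rscale_def prod_eq_iff)

section \<open>Quaternionic lines and their orthogonal complements\<close>

definition perp :: "quat2 set \<Rightarrow> quat2 set" where
  "perp K = {y. \<forall>x\<in>K. herm y x = 0}"

lemma range_rscale_HP1: "x \<noteq> 0 \<Longrightarrow> range (rscale x) \<in> HP1"
  unfolding HP1_def by blast

lemma HP1_generated:
  assumes "K \<in> HP1" "x \<in> K" "x \<noteq> 0"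
  shows "K = range (rscale x)"
proof -
  have "range (rscale x) \<in> HP1" using assms(3) by (rule range_rscale_HP1)
  moreover have "x \<in> range (rscale x)" by (metis rangeI rscale_simps(4))
  ultimately show ?thesis using HP1_eqI assms by blast
qed

lemma HP1_nonzero:
  assumes "K \<in> HP1" obtains x where "x \<in> K" "x \<noteq> 0"
proof -
  from assms obtain x where x: "x \<noteq> 0" "K = range (rscale x)" by (auto simp: HP1_def)
  have "x \<in> K" unfolding x by (metis rangeI rscale_simps(4))
  with x that show ?thesis by blast
qed

lemma perp_iff:
  assumes "K \<in> HP1" "x \<in> K" "x \<noteq> 0"
  shows "y \<in> perp K \<longleftrightarrow> herm y x = 0"
  unfolding perp_def HP1_generated[OF assms] by (auto simp: image_iff intro: exI[of _ 1])

lemma perp_HP1: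
  assumes "K \<in> HP1" shows "perp K \<in> HP1"
proof -
  obtain x where x: "x \<in> K" "x \<noteq> 0" using HP1_nonzero[OF assms] by blast
  obtain a b where ab: "x = (a, b)" by fastforce
  note iff = perp_iff[OF assms x]
  show ?thesis
  proof (cases "a = 0")
    case True
    then have "b \<noteq> 0" using x ab by (auto simp: zero_prod_def)
    have "y \<in> perp K \<longleftrightarrow> y \<in> range (rscale (1, 0))" for y
      using \<open>b \<noteq> 0\<close> unfolding iff by (cases y) (auto simp: herm_def ab True rscale_def)
    then have "perp K = range (rscale (1, 0))" by blast
    moreover have "(1, 0) \<noteq> (0 :: quat2)" by (simp add: zero_prod_def)
    ultimately show ?thesis using range_rscale_HP1 by metis
  next
    case False
    define k where "k = (- qconj (b * inverse a), 1 :: quat)"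
    have "y \<in> perp K \<longleftrightarrow> y \<in> range (rscale k)" for y
    proof
      assume "y \<in> perp K"
      then have "qconj (fst y) * a = - (qconj (snd y) * b)"
        unfolding iff by (simp add: herm_def ab eq_neg_iff_add_eq_0)
      then have "qconj (fst y) * a * inverse a = - (qconj (snd y) * b) * inverse a" by simp
      then have "qconj (fst y) = - (qconj (snd y) * (b * inverse a))"
        using False by (simp add: mult.assoc)
      then have "qconj (qconj (fst y)) = qconj (- (qconj (snd y) * (b * inverse a)))"
        by (rule arg_cong)
      then have "fst y = - qconj (b * inverse a) * snd y"
        by (simp del: qconj_simps(1) add: qconj_simps(1)[of _ "b * inverse a"])
      then have "y = rscale k (snd y)" by (simp add: k_def rscale_def prod_eq_iff)
      then show "y \<in> range (rscale k)" by blast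
    next
      assume "y \<in> range (rscale k)"
      then obtain c where c: "y = rscale k c" by blast
      have "herm k x = 0" using False by (simp add: k_def herm_def ab mult.assoc)
      then show "y \<in> perp K" unfolding iff c by simp
    qed
    then have "perp K = range (rscale k)" by blast
    moreover have "k \<noteq> 0" by (simp add: k_def prod_eq_iff)
    ultimately show ?thesis using range_rscale_HP1 by metis
  qed
qed

lemma perp_perp:
  assumes "K \<in> HP1" shows "perp (perp K) = K"
proof -
  obtain x where x: "x \<in> K" "x \<noteq> 0" using HP1_nonzero[OF assms] by blast
  have "x \<in> perp (perp K)" using x by (auto simp: perp_def) (metis herm_commute qconj_simps(6))
  then show ?thesis using HP1_eqI perp_HP1 assms x by blast
qed

lemma perp_inject: "K \<in> HP1 \<Longrightarrow> K' \<in> HP1 \<Longrightarrow> perp K = perp K' \<longleftrightarrow> K = K'"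
  by (metis perp_perp)

text \<open>
  Pairing with \<open>x\<close> identifies \<open>perp K\<close>, the dual of \<open>\<H>\<^sup>2/K\<close>, with \<open>\<H>\<close> as soon as \<open>x\<close> is nonzero modulo \<open>K\<close>.
\<close>

lemma unit_covector:
  assumes "K \<in> HP1" "x \<notin> K"
  shows "\<exists>!y. y \<in> perp K \<and> herm y x = 1"
proof -
  obtain k where k: "k \<in> perp K" "k \<noteq> 0" using HP1_nonzero[OF perp_HP1[OF assms(1)]] by blast
  have "x \<in> K \<longleftrightarrow> herm k x = 0"
    using perp_iff[OF perp_HP1[OF assms(1)] k, of x] perp_perp[OF assms(1)]
    by (metis herm_commute qconj_simps(6,8))
  then have nz: "herm k x \<noteq> 0" using assms by simp
  show ?thesis
  proof (rule ex1I, rule conjI)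
    show "rscale k (qconj (inverse (herm k x))) \<in> perp K"
      using HP1_closed(4)[OF perp_HP1[OF assms(1)]] k by blast
    show "herm (rscale k (qconj (inverse (herm k x)))) x = 1" using nz by simp
  next
    fix y assume y: "y \<in> perp K \<and> herm y x = 1"
    then obtain c where c: "y = rscale k c"
      using HP1_generated[OF perp_HP1[OF assms(1)] k] by blast
    with y have "qconj c * herm k x = 1" by simp
    then have "qconj c = inverse (herm k x)" by (metis inverse_unique inverse_inverse_eq nz right_inverse mult.assoc mult_1_left mult_1_right)
    then show "y = rscale k (qconj (inverse (herm k x)))" unfolding c by (metis qconj_simps(5))
  qed
qed

section \<open>Lattices in the plane\<close>

lemma lattice_group:
  assumes "discrete_torus \<Gamma>"
  shows "0 \<in> \<Gamma>" "p \<in> \<Gamma> \<Longrightarrow> q \<in> \<Gamma> \<Longrightarrow> p + q \<in> \<Gamma>" "p \<in> \<Gamma> \<Longrightarrow> - p \<in> \<Gamma>"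
    "p \<in> \<Gamma> \<Longrightarrow> q \<in> \<Gamma> \<Longrightarrow> p - q \<in> \<Gamma>"
proof -
  obtain \<gamma> \<eta> where "lattice_basis \<Gamma> \<gamma> \<eta>"
    using conjunct1[OF assms[unfolded discrete_torus_def]] by blast
  then have \<Gamma>: "\<Gamma> = {ismult m \<gamma> + ismult n \<eta> | m n. True}"
    unfolding lattice_basis_def by (rule conjunct2)
  have "0 = ismult 0 \<gamma> + ismult 0 \<eta>" by (simp add: ismult_def prod_eq_iff)
  then show "0 \<in> \<Gamma>" unfolding \<Gamma> by blast
  show "p + q \<in> \<Gamma>" if "p \<in> \<Gamma>" "q \<in> \<Gamma>" for p q
  proof -
    from that obtain a b c d where "p = ismult a \<gamma> + ismult b \<eta>" "q = ismult c \<gamma> + ismult d \<eta>"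
      unfolding \<Gamma> by blast
    then have "p + q = ismult (a + c) \<gamma> + ismult (b + d) \<eta>"
      by (simp add: ismult_def prod_eq_iff algebra_simps)
    then show ?thesis unfolding \<Gamma> by blast
  qed
  note add = this
  show "- p \<in> \<Gamma>" if "p \<in> \<Gamma>" for p
  proof -
    from that obtain a b where "p = ismult a \<gamma> + ismult b \<eta>"
      unfolding \<Gamma> by blast
    then have "- p = ismult (- a) \<gamma> + ismult (- b) \<eta>"
      by (simp add: ismult_def prod_eq_iff)
    then show ?thesis unfolding \<Gamma> by blast
  qed
  then show "p - q \<in> \<Gamma>" if "p \<in> \<Gamma>" "q \<in> \<Gamma>" for p q
    using add[of p "- q"] that by simp
qed

text \<open>
  By Cramer's rule the determinant of a basis of \<open>\<Gamma>\<close> times any vector is in \<open>\<Gamma>\<close>, so the residues of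
  the coordinates modulo the determinant cover all classes.  The map \<open>r\<close> picks representatives.
\<close>

lemma lattice_finite_index:
  assumes "discrete_torus \<Gamma>"
  obtains F r where "finite F" "\<And>p. r p \<in> F" "\<And>p. p - r p \<in> \<Gamma>" "\<And>p. p \<in> F \<Longrightarrow> r p = p"
    "\<And>p q. p - q \<in> \<Gamma> \<Longrightarrow> r p = r q"
proof -
  note grp = lattice_group[OF assms]
  define r where "r p = (SOME q. q - p \<in> \<Gamma>)" for p
  have r: "r p - p \<in> \<Gamma>" for p
    unfolding r_def by (rule someI[of _ p]) (simp add: grp)
  have r': "p - r p \<in> \<Gamma>" for p using grp(3)[OF r[of p]] by simp
  have cong: "r p = r q" if "p - q \<in> \<Gamma>" for p q
  proof -
    have "s - p \<in> \<Gamma> \<longleftrightarrow> s - q \<in> \<Gamma>" for s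
      using grp(2)[OF _ that, of "s - p"] grp(4)[OF _ that, of "s - q"] by auto
    then show ?thesis unfolding r_def by simp
  qed
  obtain \<gamma> \<eta> where "lattice_basis \<Gamma> \<gamma> \<eta>"
    using conjunct1[OF assms[unfolded discrete_torus_def]] by blast
  then have d: "det2 \<gamma> \<eta> \<noteq> 0" and \<Gamma>: "\<Gamma> = {ismult m \<gamma> + ismult n \<eta> | m n. True}"
    unfolding lattice_basis_def by (rule conjunct1, rule conjunct2)
  let ?d = "det2 \<gamma> \<eta>"
  let ?D = "\<bar>?d\<bar>"
  have mult: "ismult ?d p \<in> \<Gamma>" for p
  proof -
    have "ismult ?d p = ismult (det2 p \<eta>) \<gamma> + ismult (det2 \<gamma> p) \<eta>"
      by (simp add: ismult_def det2_def prod_eq_iff algebra_simps)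
    then show ?thesis unfolding \<Gamma> by blast
  qed
  have "r p \<in> r ` ({0..<?D} \<times> {0..<?D})" for p
  proof -
    let ?q = "(fst p mod ?D, snd p mod ?D)"
    have "p - ?q = ismult ?d (ismult (sgn ?d) (fst p div ?D, snd p div ?D))"
    proof -
      have "a - a mod ?D = ?d * (sgn ?d * (a div ?D))" for a
        unfolding minus_mod_eq_mult_div by (simp add: abs_sgn[of ?d] mult.assoc)
      then show ?thesis by (simp add: ismult_def prod_eq_iff)
    qed
    then have "r p = r ?q" using mult cong by metis
    moreover have "?q \<in> {0..<?D} \<times> {0..<?D}" using d by simp
    ultimately show ?thesis by blast
  qed
  then have "range r \<subseteq> r ` ({0..<?D} \<times> {0..<?D})" by blast
  then have "finite (range r)" by (rule finite_subset) simp
  moreover have "r p = p" if "p \<in> range r" for p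
    using that cong[OF r] by auto
  ultimately show ?thesis using that[of "range r" r] r' cong by blast
qed

text \<open>
  Summation by parts on the torus rests on this translation invariance.
\<close>

lemma sum_shift_periodic:
  fixes f :: "vertex \<Rightarrow> real"
  assumes "finite F" and r: "\<And>p. r p \<in> F" "\<And>p. p - r p \<in> \<Gamma>" "\<And>p. p \<in> F \<Longrightarrow> r p = p"
    "\<And>p q. p - q \<in> \<Gamma> \<Longrightarrow> r p = r q"
    and per: "\<And>g p. g \<in> \<Gamma> \<Longrightarrow> f (g + p) = f p"
  shows "(\<Sum>p\<in>F. f (p + e)) = (\<Sum>p\<in>F. f p)"
proof (rule sum.reindex_bij_witness[of _ "\<lambda>p. r (p - e)" "\<lambda>p. r (p + e)"])
  have f: "f (r p) = f p" for p
    using per[OF r(2), of p "r p"] by simp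
  have rr: "r (r p + e) = r (p + e)" for p e
    using r(4)[of "p + e" "r p + e"] r(2)[of p] by simp
  fix p assume "p \<in> F"
  show "r (p + e) \<in> F" "r (p - e) \<in> F" by (rule r)+
  show "r (r (p + e) - e) = p" "r (r (p - e) + e) = p"
    using rr[of "p + e" "- e"] rr[of "p - e" e] r(3)[OF \<open>p \<in> F\<close>] by simp_all
  show "f (r (p + e)) = f (p + e)" by (rule f)
qed

section \<open>Kernel and cokernel of a square linear system\<close>

lemma singular_matrix_transpose:
  fixes M :: "'i \<Rightarrow> 'i \<Rightarrow> real"
  assumes I: "finite I" and x: "k \<in> I" "x k \<noteq> 0" "\<And>i. i \<in> I \<Longrightarrow> (\<Sum>j\<in>I. M i j * x j) = 0"
  shows "\<exists>y. (\<exists>i\<in>I. y i \<noteq> 0) \<and> (\<forall>j\<in>I. (\<Sum>i\<in>I. y i * M i j) = 0)"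
proof -
  define n where "n = card I"
  obtain f where f: "bij_betw f {0..<n} I"
    using ex_bij_betw_nat_finite[OF I] unfolding n_def by blast
  have sumI: "(\<Sum>i\<in>I. g i) = (\<Sum>i = 0..<n. g (f i))" for g :: "'i \<Rightarrow> real"
    using sum.reindex_bij_betw[OF f, of g] by simp
  have fI: "i < n \<Longrightarrow> f i \<in> I" for i using f by (auto simp: bij_betw_def)
  have If: "\<exists>i<n. f i = j" if "j \<in> I" for j using f that by (auto simp: bij_betw_def)
  define A where "A = mat n n (\<lambda>(i, j). M (f i) (f j))"
  define v where "v = vec n (\<lambda>i. x (f i))"
  have A: "A \<in> carrier_mat n n" and v: "v \<in> carrier_vec n" by (simp_all add: A_def v_def)
  have "A *\<^sub>v v = 0\<^sub>v n"
    using x(3) fI by (auto simp: A_def v_def scalar_prod_def sumI intro!: eq_vecI)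
  moreover have "v \<noteq> 0\<^sub>v n"
  proof
    assume 0: "v = 0\<^sub>v n"
    obtain i where "i < n" "f i = k" using If x(1) by blast
    then show False using x(2) arg_cong[OF 0, of "\<lambda>v. vec_index v i"] by (simp add: v_def)
  qed
  ultimately have "Determinant.det A = 0"
    using det_0_iff_vec_prod_zero_field[OF A] v by blast
  then have "Determinant.det (transpose_mat A) = 0" by (simp add: Determinant.det_transpose[OF A])
  then obtain w where w: "w \<in> carrier_vec n" "w \<noteq> 0\<^sub>v n" "transpose_mat A *\<^sub>v w = 0\<^sub>v n"
    using det_0_iff_vec_prod_zero_field[of "transpose_mat A" n] A by auto
  define y where "y = (\<lambda>j. vec_index w (inv_into {0..<n} f j))"
  have y: "y (f i) = vec_index w i" if "i < n" for i
    unfolding y_def using that f by (simp add: bij_betw_def inv_into_f_f)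
  obtain i where i: "i < n" "vec_index w i \<noteq> 0"
    using w by (metis eq_vecI carrier_vecD index_zero_vec)
  have "(\<Sum>i\<in>I. y i * M i j) = 0" if "j \<in> I" for j
  proof -
    obtain j' where j': "j' < n" "f j' = j" using If \<open>j \<in> I\<close> by blast
    have "0 = vec_index (transpose_mat A *\<^sub>v w) j'" using w j' by simp
    also have "\<dots> = (\<Sum>i = 0..<n. M (f i) j * vec_index w i)"
      using w(1) j' by (simp add: scalar_prod_def A_def)
    also have "\<dots> = (\<Sum>i\<in>I. y i * M i j)" by (simp add: sumI y mult.commute)
    finally show ?thesis by simp
  qed
  moreover have "y (f i) \<noteq> 0" "f i \<in> I" using i y fI by auto
  ultimately show ?thesis by blast
qed

text \<open>
  An endomorphism of a finite-dimensional space that is not injective is not surjective; its image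
  is orthogonal to some nonzero \<open>y\<close>.  The space consists of the functions on \<open>F\<close>, but the elements are
  functions on the whole index type, since this is how sections on the torus enter; the fourth
  assumption says that \<open>D\<close> sees only their values on \<open>F\<close>.
\<close>

lemma kernel_gives_cokernel:
  fixes D :: "('i \<Rightarrow> 'e :: euclidean_space) \<Rightarrow> 'i \<Rightarrow> 'e"
  assumes F: "finite F"
    and add: "\<And>f g p. D (\<lambda>q. f q + g q) p = D f p + D g p"
    and scale: "\<And>c f p. D (\<lambda>q. c *\<^sub>R f q) p = c *\<^sub>R D f p"
    and local: "\<And>f g p. (\<And>q. q \<in> F \<Longrightarrow> f q = g q) \<Longrightarrow> D f p = D g p"
    and u: "\<And>p. p \<in> F \<Longrightarrow> D u p = 0" "s \<in> F" "u s \<noteq> 0"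
  shows "\<exists>y. (\<exists>p\<in>F. y p \<noteq> 0) \<and> (\<forall>f. (\<Sum>p\<in>F. inner (y p) (D f p)) = 0)"
proof -
  define \<delta> where "\<delta> = (\<lambda>(q :: 'i, b :: 'e) p. if p = q then b else 0)"
  define I where "I = F \<times> (Basis :: 'e set)"
  have I: "finite I" using F by (simp add: I_def)
  have zero: "D (\<lambda>_. 0) p = 0" for p using scale[of 0 "\<lambda>_. 0" p] by simp
  have sum: "D (\<lambda>q. \<Sum>i\<in>J. c i *\<^sub>R \<delta> i q) p = (\<Sum>i\<in>J. c i *\<^sub>R D (\<delta> i) p)" for c J p
    by (induction J rule: infinite_finite_induct) (simp_all add: zero add scale)
  have expand: "D f p = (\<Sum>i\<in>I. inner (f (fst i)) (snd i) *\<^sub>R D (\<delta> i) p)" for f p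
  proof -
    have "f q = (\<Sum>i\<in>I. inner (f (fst i)) (snd i) *\<^sub>R \<delta> i q)" if "q \<in> F" for q
    proof -
      have "(\<Sum>i\<in>I. inner (f (fst i)) (snd i) *\<^sub>R \<delta> i q)
        = (\<Sum>q'\<in>F. \<Sum>b\<in>Basis. inner (f q') b *\<^sub>R (if q = q' then b else 0))"
        unfolding I_def \<delta>_def by (simp add: sum.cartesian_product case_prod_beta)
      also have "\<dots> = (\<Sum>q'\<in>F. if q = q' then f q else 0)"
        by (rule sum.cong) (auto simp: euclidean_representation)
      finally show ?thesis using that F by simp
    qed
    then show ?thesis unfolding sum[symmetric] by (rule local)
  qed
  define M where "M = (\<lambda>i j. inner (D (\<delta> j) (fst i)) (snd i))"
  define x where "x = (\<lambda>i. inner (u (fst i)) (snd i))"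
  obtain b where b: "b \<in> Basis" "inner (u s) b \<noteq> 0"
    using u(3) euclidean_all_zero_iff[of "u s"] by blast
  have "(\<Sum>j\<in>I. M i j * x j) = 0" if "i \<in> I" for i
  proof -
    have "(\<Sum>j\<in>I. M i j * x j) = inner (D u (fst i)) (snd i)"
      by (simp add: expand[of u] M_def x_def inner_sum_left mult.commute)
    with u(1) that show ?thesis by (auto simp: I_def)
  qed
  moreover have "(s, b) \<in> I" "x (s, b) \<noteq> 0" using b u by (simp_all add: I_def x_def)
  ultimately obtain w where w: "\<exists>i\<in>I. w i \<noteq> 0" "\<And>j. j \<in> I \<Longrightarrow> (\<Sum>i\<in>I. w i * M i j) = 0"
    using singular_matrix_transpose[OF I, of "(s, b)" x M] by blast
  define y where "y p = (\<Sum>b\<in>Basis. w (p, b) *\<^sub>R b)" for p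
  from w(1) obtain p c where pc: "p \<in> F" "c \<in> Basis" "w (p, c) \<noteq> 0" unfolding I_def by auto
  then have "inner (y p) c \<noteq> 0" unfolding y_def by (simp add: inner_sum_left_Basis)
  then have "\<exists>p\<in>F. y p \<noteq> 0" using pc(1) by (metis inner_zero_left)
  moreover have "(\<Sum>p\<in>F. inner (y p) (D f p)) = 0" for f
  proof -
    have "(\<Sum>p\<in>F. inner (y p) (D f p)) = (\<Sum>i\<in>I. w i * inner (snd i) (D f (fst i)))"
      by (simp add: y_def I_def inner_sum_left sum.cartesian_product case_prod_beta)
    also have "\<dots> = (\<Sum>i\<in>I. w i * (\<Sum>j\<in>I. inner (f (fst j)) (snd j) * M i j))"
      by (simp add: expand[of f] inner_sum_right M_def inner_commute)
    also have "\<dots> = (\<Sum>j\<in>I. inner (f (fst j)) (snd j) * (\<Sum>i\<in>I. w i * M i j))"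
      unfolding sum_distrib_left by (subst sum.swap) (simp add: mult_ac)
    also have "\<dots> = 0" using w(2) by simp
    finally show ?thesis .
  qed
  ultimately show ?thesis by blast
qed

section \<open>Closed forms on the lattice of vertices\<close>

definition e1 :: vertex where "e1 = (1, 0)"
definition e2 :: vertex where "e2 = (0, 1)"

lemma int_antidifference:
  fixes f :: "int \<Rightarrow> 'a :: ab_group_add"
  shows "\<exists>s. s 0 = 0 \<and> (\<forall>n. s (n + 1) = s n + f n)"
proof -
  define s where "s n = (\<Sum>i\<in>{0..<n}. f i) - (\<Sum>i\<in>{n..<0}. f i)" for n
  have "s (n + 1) = s n + f n" for n
  proof (cases "n \<ge> 0")
    case True
    then have "{0..<n + 1} = insert n {0..<n}" by auto
    then show ?thesis using True by (simp add: s_def)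
  next
    case False
    then have "{n..<0} = insert n {n + 1..<0}" by auto
    then show ?thesis using False by (simp add: s_def)
  qed
  moreover have "s 0 = 0" by (simp add: s_def)
  ultimately show ?thesis by blast
qed

lemma vertex_induct:
  assumes "P 0" and "\<And>p. P (p + e1) \<longleftrightarrow> P p" and "\<And>p. P (p + e2) \<longleftrightarrow> P p"
  shows "P p"
proof -
  have 1: "P (m, 0)" for m
  proof (induction m rule: int_induct[where k = 0])
    case base then show ?case using assms(1) by (simp add: zero_prod_def)
  next
    case (step1 i) then show ?case using assms(2)[of "(i, 0)"] by (simp add: e1_def)
  next
    case (step2 i) then show ?case using assms(2)[of "(i - 1, 0)"] by (simp add: e1_def)
  qed
  have "P (m, n)" for m n
  proof (induction n rule: int_induct[where k = 0])
    case base then show ?case by (rule 1)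
  next
    case (step1 i) then show ?case using assms(3)[of "(m, i)"] by (simp add: e2_def)
  next
    case (step2 i) then show ?case using assms(3)[of "(m, i - 1)"] by (simp add: e2_def)
  qed
  then show ?thesis by (cases p) simp
qed

text \<open>
  A 1-form on \<open>\<int>\<^sup>2\<close> is given by its values \<open>A p\<close> and \<open>B p\<close> on the edges from \<open>p\<close> to \<open>p + e1\<close> and
  \<open>p + e2\<close>; it is closed if the two paths from \<open>p\<close> to \<open>p + e1 + e2\<close> have the same integral.  The
  primitive is found by integrating along the first axis and then vertically.
\<close>

lemma closed_form_primitive:
  fixes A B :: "vertex \<Rightarrow> 'a :: ab_group_add"
  assumes closed: "\<And>p. A p + B (p + e1) = B p + A (p + e2)"
  obtains k where "\<And>p. k (p + e1) = k p + A p" "\<And>p. k (p + e2) = k p + B p"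
proof -
  obtain s where s: "s 0 = 0" "\<And>n. s (n + 1) = s n + A (n, 0)"
    using int_antidifference[of "\<lambda>n. A (n, 0)"] by blast
  have "\<exists>t. t 0 = 0 \<and> (\<forall>n. t (n + 1) = t n + B (m, n))" for m
    using int_antidifference[of "\<lambda>n. B (m, n)"] .
  then obtain t where t: "\<And>m. t m 0 = 0" "\<And>m n. t m (n + 1) = t m n + B (m, n)" by metis
  define k where "k p = s (fst p) + t (fst p) (snd p)" for p
  have vert: "k (p + e2) = k p + B p" for p
    by (simp add: k_def e2_def t add.assoc)
  have "k ((m, n) + e1) = k (m, n) + A (m, n)" for m n
  proof (induction n rule: int_induct[where k = 0])
    case base then show ?case by (simp add: k_def e1_def s t)
  next
    case (step1 n)
    have "k ((m, n + 1) + e1) = k ((m, n) + e1) + B ((m, n) + e1)"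
      using vert[of "(m, n) + e1"] by (simp add: e1_def e2_def)
    also have "\<dots> = k (m, n) + (A (m, n) + B ((m, n) + e1))" by (simp add: step1 add.assoc)
    also have "\<dots> = k (m, n) + B (m, n) + A (m, n + 1)"
      unfolding closed by (simp add: e2_def add.assoc)
    finally show ?case using vert[of "(m, n)"] by (simp add: e2_def)
  next
    case (step2 n)
    have "k ((m, n - 1) + e1) + B ((m, n - 1) + e1) = k (m, n) + A (m, n)"
      using vert[of "(m, n - 1) + e1"] step2 by (simp add: e1_def e2_def)
    also have "\<dots> = k (m, n - 1) + (B (m, n - 1) + A ((m, n - 1) + e2))"
      using vert[of "(m, n - 1)"] by (simp add: e2_def add.assoc)
    also have "\<dots> = k (m, n - 1) + A (m, n - 1) + B ((m, n - 1) + e1)"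
      unfolding closed[symmetric] by (simp add: add.assoc)
    finally show ?case by simp
  qed
  then have "k (p + e1) = k p + A p" for p by (cases p) simp
  then show ?thesis using vert that by blast
qed

definition equivariant ::
  "vertex set \<Rightarrow> (vertex \<Rightarrow> complex) \<Rightarrow> (vertex \<Rightarrow> quat2) \<Rightarrow> bool" where
  "equivariant \<Gamma> c x \<longleftrightarrow> (\<forall>g\<in>\<Gamma>. \<forall>p. x (g + p) = rscale (x p) (quat_of_complex (c g)))"

lemma equivariantD:
  "equivariant \<Gamma> c x \<Longrightarrow> g \<in> \<Gamma> \<Longrightarrow> x (g + p) = rscale (x p) (quat_of_complex (c g))"
  unfolding equivariant_def by blast

text \<open>
  The first cohomology of a torus with coefficients in a nontrivial character vanishes.  A primitive
  of an equivariant form is equivariant up to constants \<open>t g\<close>; the one for \<open>g0\<close> is removed by adding a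
  constant \<open>w\<close> to the primitive, as \<open>c g0 - 1\<close> is invertible, and the others then vanish because \<open>g0\<close>
  commutes with every \<open>g\<close>.
\<close>

lemma equivariant_primitive:
  assumes c: "\<And>g g'. g \<in> \<Gamma> \<Longrightarrow> g' \<in> \<Gamma> \<Longrightarrow> c (g + g') = c g * c g'"
    and g0: "g0 \<in> \<Gamma>" "c g0 \<noteq> 1"
    and AB: "equivariant \<Gamma> c A" "equivariant \<Gamma> c B"
    and closed: "\<And>p. A p + B (p + e1) = B p + A (p + e2)"
  obtains k where "equivariant \<Gamma> c k"
    "\<And>p. k (p + e1) = k p + A p" "\<And>p. k (p + e2) = k p + B p"
proof -
  let ?c = "\<lambda>g. quat_of_complex (c g)"
  obtain k where k: "\<And>p. k (p + e1) = k p + A p" "\<And>p. k (p + e2) = k p + B p"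
    using closed_form_primitive[OF closed] by blast
  have defect: "k (g + p) = rscale (k p) (?c g) + (k g - rscale (k 0) (?c g))" if "g \<in> \<Gamma>" for g p
  proof (induction p rule: vertex_induct)
    case 1 then show ?case by simp
  next
    case (2 p)
    have "A (g + p) = rscale (A p) (?c g)" by (rule equivariantD[OF AB(1) that])
    then show ?case using k(1)[of "g + p"] by (auto simp: k add.assoc[symmetric] rscale_simps)
  next
    case (3 p)
    have "B (g + p) = rscale (B p) (?c g)" by (rule equivariantD[OF AB(2) that])
    then show ?case using k(2)[of "g + p"] by (auto simp: k add.assoc[symmetric] rscale_simps)
  qed
  define t where "t g = k g - rscale (k 0) (?c g)" for g
  have nz: "?c g0 - 1 \<noteq> 0"
    using g0(2) quat_of_complex_simps(4)[of "c g0" 1] by simp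
  define w where "w = rscale (t g0) (inverse (?c g0 - 1))"
  have w: "rscale w (?c g0) = t g0 + w"
  proof -
    have "rscale w (?c g0 - 1) = t g0" using nz by (simp add: w_def rscale_simps(1,4))
    then show ?thesis using rscale_simps(2)[of w "?c g0 - 1" 1] by (simp add: rscale_simps(4))
  qed
  define k' where "k' p = k p + w" for p
  define t' where "t' g = t g + w - rscale w (?c g)" for g
  have k': "k' (g + p) = rscale (k' p) (?c g) + t' g" if "g \<in> \<Gamma>" for g p
    using defect[OF that, of p] by (simp add: k'_def t'_def t_def rscale_simps)
  have "t' g0 = 0" by (simp add: t'_def w)
  have "t' g = 0" if "g \<in> \<Gamma>" for g
  proof -
    have "rscale (rscale (k' 0) (?c g0)) (?c g) + t' g = k' (g + g0)"
      using k'[OF g0(1), of 0] k'[OF that, of g0] \<open>t' g0 = 0\<close> by simp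
    also have "\<dots> = rscale (rscale (k' 0) (?c g) + t' g) (?c g0)"
      using k'[OF that, of 0] k'[OF g0(1), of g] \<open>t' g0 = 0\<close> by (simp add: add.commute)
    finally have "rscale (t' g) (?c g0) = t' g"
      by (simp add: rscale_simps complex_quat_commute[of "c g" "c g0"])
    then have "rscale (t' g) (?c g0 - 1) = 0"
      using rscale_simps(2)[of "t' g" "?c g0 - 1" 1] by (simp add: rscale_simps(4))
    then show ?thesis using nz rscale_eq_0_iff by blast
  qed
  then have "equivariant \<Gamma> c k'" using k' by (simp add: equivariant_def)
  then show ?thesis using that[of k'] k by (simp add: k'_def algebra_simps)
qed

section \<open>The spectrum of a line field and duality\<close>

text \<open>
  Here \<open>x p\<close> is the value at the black triangle \<open>p, p + e1, p + e2\<close> of the prolongation of a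
  holomorphic section of \<open>V/A\<close>.  The black triangles at the vertex \<open>p\<close> are those with index \<open>p\<close>,
  \<open>p - e1\<close> and \<open>p - e2\<close>, and there the values of \<open>x\<close> have to agree modulo \<open>A p\<close>.
\<close>

definition monodromies :: "vertex set \<Rightarrow> (vertex \<Rightarrow> quat2 set) \<Rightarrow> (vertex \<Rightarrow> complex) set" where
  "monodromies \<Gamma> A = {h \<in> Hom \<Gamma>. \<exists>x. equivariant \<Gamma> h x \<and> (\<exists>p. x p \<noteq> 0) \<and>
     (\<forall>p. x p - x (p - e1) \<in> A p \<and> x p - x (p - e2) \<in> A p)}"

text \<open>
  The half turn \<open>p \<mapsto> - p\<close> exchanges the black and the white triangles, so that the orthogonal
  complement, which lives naturally on the torus with exchanged colours, becomes a line field of the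
  same kind again.
\<close>

definition dual :: "(vertex \<Rightarrow> quat2 set) \<Rightarrow> vertex \<Rightarrow> quat2 set" where
  "dual A p = perp (A (- p))"

text \<open>
  The prolongations with monodromy \<open>h\<close> are the equivariant solutions of two quaternionic equations
  per vertex, \<open>herm (\<beta> p) (x p - x (p - e\<^sub>i)) = 0\<close> with \<open>\<beta> p\<close> spanning \<open>perp (A p)\<close>, for unknowns in
  \<open>\<H>\<^sup>2\<close> per black triangle.  As there are as many vertices as black triangles modulo \<open>\<Gamma>\<close>, a nontrivial
  solution yields a cokernel element \<open>Y\<close>, two quaternions per vertex with the inverse conjugate
  monodromy.  Summation by parts shows that the vectors \<open>\<beta> p\<close> times these quaternions form a closed
  1-form; its primitive solves the equations for \<open>dual A\<close> after the half turn.
\<close>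

lemma monodromies_dual:
  assumes torus: "discrete_torus \<Gamma>"
    and A: "\<And>p. A p \<in> HP1" "\<And>g p. g \<in> \<Gamma> \<Longrightarrow> A (g + p) = A p"
  shows "monodromies \<Gamma> A \<subseteq> monodromies \<Gamma> (dual A)"
proof
  note grp = lattice_group[OF torus]
  fix h assume "h \<in> monodromies \<Gamma> A"
  then obtain x where h: "h \<in> Hom \<Gamma>" and x: "equivariant \<Gamma> h x" "\<exists>p. x p \<noteq> 0"
      "\<And>p. x p - x (p - e1) \<in> A p" "\<And>p. x p - x (p - e2) \<in> A p"
    unfolding monodromies_def by blast
  have hom: "h (g + g') = h g * h g'" "h g \<noteq> 0" if "g \<in> \<Gamma>" "g' \<in> \<Gamma>" for g g'
    using h that by (auto simp: Hom_def)
  show "h \<in> monodromies \<Gamma> (dual A)"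
  proof (cases "\<exists>g\<in>\<Gamma>. h g \<noteq> 1")
    case False
    \<comment> \<open>A constant vector is a prolongation with trivial monodromy for any line field.\<close>
    have "equivariant \<Gamma> h (\<lambda>_. (1, 0))"
      using False by (simp add: equivariant_def rscale_simps)
    moreover have "0 \<in> dual A p" for p
      unfolding dual_def by (rule HP1_closed(1)[OF perp_HP1[OF A(1)]])
    moreover have "(1 :: quat, 0 :: quat) \<noteq> 0" by (simp add: zero_prod_def)
    ultimately show ?thesis using h unfolding monodromies_def
      by (intro CollectI conjI exI[of _ "\<lambda>_. (1, 0)"] allI) simp_all
  next
    case True
    then obtain g0 where g0: "g0 \<in> \<Gamma>" "h g0 \<noteq> 1" by blast
    obtain F r where F: "finite F" and r: "\<And>p. r p \<in> F" "\<And>p. p - r p \<in> \<Gamma>"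
        "\<And>p. p \<in> F \<Longrightarrow> r p = p" "\<And>p q. p - q \<in> \<Gamma> \<Longrightarrow> r p = r q"
      using lattice_finite_index[OF torus] by blast
    have rg: "r (g + p) = r p" if "g \<in> \<Gamma>" for g p using r(4)[of "g + p" p] that by simp
    \<comment> \<open>The monodromy for which the real pairing with sections of monodromy \<open>h\<close> is \<open>\<Gamma>\<close>-periodic.\<close>
    define c where "c g = cnj (inverse (h g))" for g
    have chom: "c (g + g') = c g * c g'" if "g \<in> \<Gamma>" "g' \<in> \<Gamma>" for g g'
      using hom(1)[OF that] by (simp add: c_def)
    have unit: "d 0 = 1" if "\<And>g g'. g \<in> \<Gamma> \<Longrightarrow> g' \<in> \<Gamma> \<Longrightarrow> d (g + g') = d g * d g'" "d 0 \<noteq> 0"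
      for d :: "vertex \<Rightarrow> complex"
      using that(1)[OF grp(1) grp(1)] that(2) by simp
    have h0: "h 0 = 1" using unit[of h] hom grp(1) by blast
    have c0: "c 0 = 1" by (simp add: c_def h0)
    have cneg: "c (- g) = cnj (h g)" if "g \<in> \<Gamma>" for g
    proof -
      have "h g * h (- g) = 1" using hom(1)[OF that grp(3)[OF that]] h0 by simp
      then show ?thesis unfolding c_def by (metis inverse_unique mult.commute)
    qed
    \<comment> \<open>The equivariant extension of the values on the set \<open>F\<close> of representatives.\<close>
    define ext where "ext d f p = rscale (f (r p)) (quat_of_complex (d (p - r p)))"
      for d :: "vertex \<Rightarrow> complex" and f :: "vertex \<Rightarrow> quat2" and p
    have ext: "equivariant \<Gamma> d (ext d f)"
      if "\<And>g g'. g \<in> \<Gamma> \<Longrightarrow> g' \<in> \<Gamma> \<Longrightarrow> d (g + g') = d g * d g'" for d f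
      unfolding equivariant_def
    proof (intro ballI allI)
      fix g p assume "g \<in> \<Gamma>"
      have "d (g + p - r p) = d (p - r p) * d g"
        using that[OF r(2)[of p] \<open>g \<in> \<Gamma>\<close>] by (simp add: algebra_simps)
      then show "ext d f (g + p) = rscale (ext d f p) (quat_of_complex (d g))"
        by (simp add: ext_def rg[OF \<open>g \<in> \<Gamma>\<close>] rscale_simps)
    qed
    have ext_id: "ext d f = f" if "equivariant \<Gamma> d f" for d f
    proof
      fix p show "ext d f p = f p"
        using that r(2)[of p] unfolding equivariant_def ext_def by (metis diff_add_cancel)
    qed
    have ext_F: "ext d f p = f p" if "d 0 = 1" "p \<in> F" for d f p
      using that by (simp add: ext_def r(3) rscale_simps)
    define \<beta> where "\<beta> p = (SOME y. y \<in> perp (A p) \<and> y \<noteq> 0)" for p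
    have \<beta>: "\<beta> p \<in> perp (A p)" "\<beta> p \<noteq> 0" for p
      using someI_ex[of "\<lambda>y. y \<in> perp (A p) \<and> y \<noteq> 0"] HP1_nonzero[OF perp_HP1[OF A(1)]]
      unfolding \<beta>_def by blast+
    have \<beta>g: "\<beta> (g + p) = \<beta> p" if "g \<in> \<Gamma>" for g p
      by (simp add: \<beta>_def A(2)[OF that])
    define D where "D f p = (herm (\<beta> p) (ext h f p - ext h f (p - e1)),
      herm (\<beta> p) (ext h f p - ext h f (p - e2)))" for f p
    have "D x p = 0" for p
      using x(3,4)[of p] \<beta>(1)[of p]
      by (simp add: D_def ext_id[OF x(1)] perp_def zero_prod_def del: herm_simps)
    moreover have "\<exists>s\<in>F. x s \<noteq> 0"
    proof -
      obtain p where "x p \<noteq> 0" using x(2) by blast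
      then have "x (r p) \<noteq> 0"
        using ext_id[OF x(1)] by (metis ext_def rscale_simps(6))
      with r(1) show ?thesis by blast
    qed
    moreover have "D (\<lambda>q. f q + g q) p = D f p + D g p" for f g p
      by (simp add: D_def ext_def rscale_simps)
    moreover have "D (\<lambda>q. a *\<^sub>R f q) p = a *\<^sub>R D f p" for a f p
      by (simp add: D_def ext_def scaleR_diff_right)
    moreover have "D f p = D g p" if "\<And>q. q \<in> F \<Longrightarrow> f q = g q" for f g p
      using that r(1) by (simp add: D_def ext_def)
    ultimately obtain y where y: "\<exists>p\<in>F. y p \<noteq> 0" "\<And>f. (\<Sum>p\<in>F. inner (y p) (D f p)) = 0"
      using kernel_gives_cokernel[OF F, of D x] by blast
    define Y where "Y = ext c y"
    have Yeq: "equivariant \<Gamma> c Y" unfolding Y_def by (rule ext[OF chom])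
    define \<alpha> where "\<alpha> p = rscale (\<beta> p) (fst (Y p))" for p
    define \<delta> where "\<delta> p = rscale (\<beta> p) (snd (Y p))" for p
    have eq: "equivariant \<Gamma> c \<alpha>" "equivariant \<Gamma> c \<delta>"
      using Yeq by (auto simp: equivariant_def \<alpha>_def \<delta>_def \<beta>g rscale_def mult.assoc)
    have shift: "equivariant \<Gamma> d (\<lambda>p. u (p + e))" if "equivariant \<Gamma> d u" for d u e
      using that unfolding equivariant_def by (metis add.assoc)
    have periodic: "inner (u (g + p)) (v (g + p)) = inner (u p) (v p)"
      if "equivariant \<Gamma> c u" "equivariant \<Gamma> h v" "g \<in> \<Gamma>" for u v g p
    proof -
      have "c g * cnj (h g) = 1" using hom(2)[OF that(3,3)] by (simp add: c_def field_simps)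
      then have "quat_of_complex (c g) * qconj (quat_of_complex (h g)) = 1"
        by (metis quat_of_complex_simps(1,2,3))
      then show ?thesis
        by (simp add: equivariantD[OF that(1,3)] equivariantD[OF that(2,3)] inner_rscale rscale_simps(1,4))
    qed
    have parts: "(\<Sum>p\<in>F. inner (u p) (v (p - e))) = (\<Sum>p\<in>F. inner (u (p + e)) (v p))"
      if "equivariant \<Gamma> c u" "equivariant \<Gamma> h v" for u v e
      using sum_shift_periodic[OF F r, of "\<lambda>p. inner (u p) (v (p - e))" e]
        periodic[OF that(1) shift[OF that(2), of "- e"]] by simp
    \<comment> \<open>\<open>Z\<close> is the adjoint operator applied to the cokernel element; its vanishing is the closedness.\<close>
    define Z where "Z p = \<alpha> p + \<delta> p - \<alpha> (p + e1) - \<delta> (p + e2)" for p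
    have Zeq: "equivariant \<Gamma> c Z"
      using eq shift[OF eq(1), of e1] shift[OF eq(2), of e2]
      by (simp add: equivariant_def Z_def rscale_simps)
    have Z_orth: "(\<Sum>p\<in>F. inner (Z p) (ext h f p)) = 0" for f
    proof -
      let ?X = "ext h f"
      have X: "equivariant \<Gamma> h ?X" by (rule ext[OF hom(1)])
      have "0 = (\<Sum>p\<in>F. inner (y p) (D f p))" using y by simp
      also have "\<dots> = (\<Sum>p\<in>F. inner (\<alpha> p) (?X p - ?X (p - e1)) + inner (\<delta> p) (?X p - ?X (p - e2)))"
      proof (rule sum.cong)
        fix p assume "p \<in> F"
        then have "y p = Y p" unfolding Y_def by (simp add: ext_F c0)
        then show "inner (y p) (D f p)
          = inner (\<alpha> p) (?X p - ?X (p - e1)) + inner (\<delta> p) (?X p - ?X (p - e2))"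
          by (cases "Y p") (simp add: D_def \<alpha>_def \<delta>_def inner_herm del: herm_simps)
      qed simp
      also have "\<dots> = (\<Sum>p\<in>F. inner (Z p) (?X p))"
        unfolding inner_diff_right sum.distrib sum_subtractf parts[OF eq(1) X] parts[OF eq(2) X] Z_def
        by (simp add: inner_diff_left inner_add_left sum.distrib sum_subtractf)
      finally show ?thesis by simp
    qed
    have "Z p = 0" for p
    proof -
      have "(\<Sum>p\<in>F. inner (Z p) (Z p)) = 0" using Z_orth[of Z] h0 by (simp add: ext_F)
      then have "Z (r p) = 0"
        using r(1)[of p] by (subst (asm) sum_nonneg_eq_0_iff[OF F]) auto
      then show ?thesis using ext_id[OF Zeq] by (metis ext_def rscale_simps(6))
    qed
    then have closed: "- \<delta> p + \<alpha> (p + e1) = \<alpha> p + - \<delta> (p + e2)" for p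
      using \<open>\<And>p. Z p = 0\<close>[of p] unfolding Z_def by (simp add: algebra_simps)
    have c1: "c g0 \<noteq> 1" using g0(2) by (simp add: c_def)
    have "equivariant \<Gamma> c (\<lambda>p. - \<delta> p)" using eq(2) by (simp add: equivariant_def rscale_simps)
    then obtain k where k: "equivariant \<Gamma> c k"
        "\<And>p. k (p + e1) = k p + - \<delta> p" "\<And>p. k (p + e2) = k p + \<alpha> p"
      using equivariant_primitive[OF chom g0(1) c1 _ eq(1) closed] by blast
    \<comment> \<open>The half turn changes the monodromy \<open>c\<close> of \<open>k\<close> into \<open>cnj h\<close>, and the factor \<open>j\<close> turns it into \<open>h\<close>.\<close>
    define x' where "x' p = rscale (k (- p)) quat_j" for p
    have "equivariant \<Gamma> h x'"
      unfolding equivariant_def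
    proof (intro ballI allI)
      fix g p assume g: "g \<in> \<Gamma>"
      have "k (- (g + p)) = rscale (k (- p)) (quat_of_complex (c (- g)))"
        using k(1) grp(3)[OF g] unfolding equivariant_def by (metis minus_add_distrib)
      then show "x' (g + p) = rscale (x' p) (quat_of_complex (h g))"
        by (simp add: x'_def rscale_simps(1) cneg[OF g] qconj_complex_mult_j)
    qed
    moreover have "\<exists>p. x' p \<noteq> 0"
    proof (rule ccontr)
      assume "\<not> ?thesis"
      then have "k p = 0" for p
        unfolding x'_def using quat_j_nonzero by (metis minus_minus rscale_eq_0_iff)
      then have "\<alpha> p = 0" "\<delta> p = 0" for p using k(2,3)[of p] by simp_all
      then have "fst (Y p) = 0" "snd (Y p) = 0" for p
        using \<beta>(2) unfolding \<alpha>_def \<delta>_def rscale_eq_0_iff by blast+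
      then have "Y p = 0" for p by (simp add: prod_eq_iff)
      then show False using y(1) ext_F[of c, OF c0] unfolding Y_def by metis
    qed
    moreover have "x' p - x' (p - e1) \<in> dual A p \<and> x' p - x' (p - e2) \<in> dual A p" for p
    proof -
      have "k (- (p - e1)) = k (- p) - \<delta> (- p)" "k (- (p - e2)) = k (- p) + \<alpha> (- p)"
        using k(2,3)[of "- p"] by simp_all
      then have "x' p - x' (p - e1) = rscale (\<delta> (- p)) quat_j"
        "x' p - x' (p - e2) = rscale (\<alpha> (- p)) (- quat_j)"
        unfolding x'_def by (simp_all add: rscale_simps)
      then show ?thesis
        unfolding dual_def \<alpha>_def \<delta>_def rscale_simps(1)
        using HP1_closed(4)[OF perp_HP1[OF A(1)] \<beta>(1)] by metis
    qed
    ultimately show ?thesis using h unfolding monodromies_def by blast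
  qed
qed

section \<open>Darboux pairs\<close>

definition immersed_net :: "vertex set \<Rightarrow> (vertex \<Rightarrow> quat2 set) \<Rightarrow> bool" where
  "immersed_net \<Gamma> A \<longleftrightarrow> (\<forall>p. A p \<in> HP1) \<and> (\<forall>g\<in>\<Gamma>. \<forall>p. A (g + p) = A p) \<and>
     (\<forall>p. A p \<noteq> A (p + e1) \<and> A p \<noteq> A (p + e2) \<and> A (p + e1) \<noteq> A (p + e2))"

lemma immersed_netD:
  assumes "immersed_net \<Gamma> A"
  shows "A p \<in> HP1" "g \<in> \<Gamma> \<Longrightarrow> A (g + p) = A p"
    "A p \<noteq> A (p + e1)" "A p \<noteq> A (p + e2)" "A (p + e1) \<noteq> A (p + e2)"
  using assms unfolding immersed_net_def by blast+

text \<open>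
  The indices of \<open>B\<close> are black triangles, those of \<open>A\<close> vertices.  The black triangles around the white
  triangle \<open>q + e1, q + e2, q + e1 + e2\<close> are \<open>q\<close>, \<open>q + e1\<close> and \<open>q + e2\<close>, and \<open>a, b, c\<close> is a parallel
  section of \<open>B\<close> on them.  Since the lines are one-dimensional, the existence of a nonzero parallel
  section around \<open>q\<close> is the flatness there.
\<close>

definition darboux_pair :: "(vertex \<Rightarrow> quat2 set) \<Rightarrow> (vertex \<Rightarrow> quat2 set) \<Rightarrow> bool" where
  "darboux_pair A B \<longleftrightarrow>
     (\<forall>q. B q \<noteq> A q \<and> B q \<noteq> A (q + e1) \<and> B q \<noteq> A (q + e2)) \<and>
     (\<forall>q. \<exists>a b c. a \<in> B q \<and> b \<in> B (q + e1) \<and> c \<in> B (q + e2) \<and> a \<noteq> 0 \<and> b \<noteq> 0 \<and> c \<noteq> 0 \<and>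
        a - b \<in> A (q + e1) \<and> a - c \<in> A (q + e2) \<and> b - c \<in> A (q + e1 + e2))"

lemma darboux_pair_distinct:
  assumes "darboux_pair A B"
  shows "B q \<noteq> A q" "B q \<noteq> A (q + e1)" "B q \<noteq> A (q + e2)"
  using assms unfolding darboux_pair_def by blast+

lemma HP1_disjoint: "K \<in> HP1 \<Longrightarrow> K' \<in> HP1 \<Longrightarrow> K \<noteq> K' \<Longrightarrow> x \<in> K \<Longrightarrow> x \<in> K' \<Longrightarrow> x = 0"
  using HP1_eqI by blast

lemma immersed_net_dual:
  assumes torus: "discrete_torus \<Gamma>" and A: "immersed_net \<Gamma> A"
  shows "immersed_net \<Gamma> (dual A)"
proof -
  have inj: "dual A p = dual A q \<longleftrightarrow> A (- p) = A (- q)" for p q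
    unfolding dual_def using perp_inject immersed_netD(1)[OF A] by blast
  show ?thesis
    unfolding immersed_net_def inj
  proof (intro conjI allI ballI)
    fix p
    show "dual A p \<in> HP1" unfolding dual_def by (rule perp_HP1[OF immersed_netD(1)[OF A]])
    show "A (- (g + p)) = A (- p)" if "g \<in> \<Gamma>" for g
      using immersed_netD(2)[OF A lattice_group(3)[OF torus that], of "- p"] by simp
    show "A (- p) \<noteq> A (- (p + e1))" "A (- p) \<noteq> A (- (p + e2))"
      using immersed_netD(3)[OF A, of "- (p + e1)"] immersed_netD(4)[OF A, of "- (p + e2)"] by simp_all
    show "A (- (p + e1)) \<noteq> A (- (p + e2))"
      using immersed_netD(5)[OF A, of "- p - e1 - e2"] by (simp add: algebra_simps)
  qed
qed

lemma dual_dual: "immersed_net \<Gamma> A \<Longrightarrow> dual (dual A) = A"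
  by (rule ext) (simp add: dual_def perp_perp immersed_netD(1))

lemma monodromies_dual_eq:
  assumes "discrete_torus \<Gamma>" "immersed_net \<Gamma> A"
  shows "monodromies \<Gamma> (dual A) = monodromies \<Gamma> A"
proof -
  have sub: "monodromies \<Gamma> A \<subseteq> monodromies \<Gamma> (dual A)" if "immersed_net \<Gamma> A" for A
    by (rule monodromies_dual[OF assms(1)]) (rule immersed_netD[OF that], assumption?)+
  show ?thesis
    using sub[OF assms(2)] sub[OF immersed_net_dual[OF assms]] dual_dual[OF assms(2)] by simp
qed

text \<open>
  A parallel section \<open>a, b, c\<close> of \<open>B\<close> around a white triangle determines covectors in the complements
  of the lines \<open>A v\<close> at its corners: at each corner, the one that is 1 on the two of the vectors \<open>a, b, c\<close>
  that agree modulo \<open>A v\<close>.  Two of these covectors agree on the vector at the black triangle between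
  their corners, which is the parallelism required of the dual pair.
\<close>

lemma darboux_pair_dual:
  assumes A: "immersed_net \<Gamma> A" and B: "immersed_net \<Gamma> B" and AB: "darboux_pair A B"
  shows "darboux_pair (dual B) (dual A)"
proof -
  note lines = immersed_netD(1)[OF A] immersed_netD(1)[OF B]
  have inj: "dual A p = dual B q \<longleftrightarrow> A (- p) = B (- q)" for p q
    unfolding dual_def using perp_inject lines by blast
  show ?thesis
    unfolding darboux_pair_def inj
  proof (intro conjI allI)
    fix q
    show "A (- q) \<noteq> B (- q)" "A (- q) \<noteq> B (- (q + e1))" "A (- q) \<noteq> B (- (q + e2))"
      using not_sym[OF darboux_pair_distinct(1)[OF AB, of "- q"]]
        not_sym[OF darboux_pair_distinct(2)[OF AB, of "- (q + e1)"]]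
        not_sym[OF darboux_pair_distinct(3)[OF AB, of "- (q + e2)"]] by simp_all
    \<comment> \<open>The vertices \<open>- q\<close>, \<open>- (q + e1)\<close>, \<open>- (q + e2)\<close> that carry the dual lines around \<open>q\<close> are the
      corners of the white triangle with index \<open>s\<close>.\<close>
    define s where "s = - q - e1 - e2"
    have s: "- q = s + e1 + e2" "- (q + e1) = s + e2" "- (q + e2) = s + e1" "- (q + e1 + e2) = s"
      by (simp_all add: s_def algebra_simps)
    obtain a b c where abc: "a \<in> B s" "b \<in> B (s + e1)" "c \<in> B (s + e2)" "a \<noteq> 0" "b \<noteq> 0" "c \<noteq> 0"
      and diff: "a - b \<in> A (s + e1)" "a - c \<in> A (s + e2)" "b - c \<in> A (s + e1 + e2)"
      using AB unfolding darboux_pair_def by blast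
    have cov: "\<exists>y. y \<in> perp (A v) \<and> y \<noteq> 0 \<and> herm y x = 1 \<and> herm y x' = 1"
      if "x \<in> B u" "x \<noteq> 0" "B u \<noteq> A v" "x - x' \<in> A v" for x x' u v
    proof -
      have "x \<notin> A v" using HP1_disjoint lines that by metis
      then obtain y where y: "y \<in> perp (A v)" "herm y x = 1" using unit_covector lines by metis
      then have "herm y (x - x') = 0" using that(4) by (auto simp: perp_def)
      then have "herm y x' = 1" using y by simp
      moreover have "y \<noteq> 0" using y by auto
      ultimately show ?thesis using y by blast
    qed
    obtain a' where a': "a' \<in> perp (A (s + e1 + e2))" "a' \<noteq> 0" "herm a' b = 1" "herm a' c = 1"
      using cov[OF abc(2,5) _ diff(3)] darboux_pair_distinct(3)[OF AB, of "s + e1"] by blast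
    obtain b' where b': "b' \<in> perp (A (s + e2))" "b' \<noteq> 0" "herm b' a = 1" "herm b' c = 1"
      using cov[OF abc(1,4) _ diff(2)] darboux_pair_distinct(3)[OF AB, of s] by blast
    obtain c' where c': "c' \<in> perp (A (s + e1))" "c' \<noteq> 0" "herm c' a = 1" "herm c' b = 1"
      using cov[OF abc(1,4) _ diff(1)] darboux_pair_distinct(2)[OF AB, of s] by blast
    have "a' - b' \<in> perp (B (s + e2))" "a' - c' \<in> perp (B (s + e1))" "b' - c' \<in> perp (B s)"
      using perp_iff[OF lines(2) abc(3,6)] perp_iff[OF lines(2) abc(2,5)] perp_iff[OF lines(2) abc(1,4)]
        a' b' c' by simp_all
    then show "\<exists>a b c. a \<in> dual A q \<and> b \<in> dual A (q + e1) \<and> c \<in> dual A (q + e2) \<and>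
        a \<noteq> 0 \<and> b \<noteq> 0 \<and> c \<noteq> 0 \<and> a - b \<in> dual B (q + e1) \<and> a - c \<in> dual B (q + e2) \<and>
        b - c \<in> dual B (q + e1 + e2)"
      unfolding dual_def s using a'(1,2) b'(1,2) c'(1,2) by blast
  qed
qed

text \<open>
  The Darboux transform of a holomorphic section.  The differences of \<open>x\<close> around a white triangle are
  multiples of those of a parallel section \<open>a, b, c\<close>, and the three factors coincide because both
  triples of differences add up to zero and the lines \<open>A v\<close> at the corners are distinct.
\<close>

lemma darboux_lift:
  assumes A: "immersed_net \<Gamma> A" and B: "immersed_net \<Gamma> B" and AB: "darboux_pair A B"
    and x: "\<And>p. x p - x (p - e1) \<in> A p" "\<And>p. x p - x (p - e2) \<in> A p"
  shows "\<exists>!y. y - x q \<in> B q \<and> y - x (q + e1) \<in> B (q + e1) \<and> y - x (q + e2) \<in> B (q + e2)"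
proof -
  note lines = immersed_netD(1)[OF A] immersed_netD(1)[OF B]
  obtain a b c where abc: "a \<in> B q" "b \<in> B (q + e1)" "c \<in> B (q + e2)" "a \<noteq> 0" "b \<noteq> 0" "c \<noteq> 0"
    and diff: "a - b \<in> A (q + e1)" "a - c \<in> A (q + e2)" "b - c \<in> A (q + e1 + e2)"
    using AB unfolding darboux_pair_def by blast
  have ne: "a - b \<noteq> 0" "a - c \<noteq> 0" "b - c \<noteq> 0"
    using HP1_disjoint[OF lines(2) lines(2) immersed_netD(3)[OF B] abc(1)]
      HP1_disjoint[OF lines(2) lines(2) immersed_netD(4)[OF B] abc(1)]
      HP1_disjoint[OF lines(2) lines(2) immersed_netD(5)[OF B] abc(2)] abc by auto
  have xd: "x q - x (q + e1) \<in> A (q + e1)" "x q - x (q + e2) \<in> A (q + e2)"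
    "x (q + e1) - x (q + e2) \<in> A (q + e1 + e2)"
  proof -
    show "x q - x (q + e1) \<in> A (q + e1)" "x q - x (q + e2) \<in> A (q + e2)"
      using HP1_closed(3)[OF lines(1) x(1)[of "q + e1"]] HP1_closed(3)[OF lines(1) x(2)[of "q + e2"]]
      by simp_all
    show "x (q + e1) - x (q + e2) \<in> A (q + e1 + e2)"
      using HP1_closed(5)[OF lines(1) x(1)[of "q + e1 + e2"] x(2)[of "q + e1 + e2"]]
        HP1_closed(3)[OF lines(1)] by (fastforce simp: algebra_simps)
  qed
  obtain \<chi>1 where 1: "x q - x (q + e1) = rscale (a - b) \<chi>1"
    using HP1_generated[OF lines(1) diff(1) ne(1)] xd(1) by blast
  obtain \<chi>2 where 2: "x q - x (q + e2) = rscale (a - c) \<chi>2"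
    using HP1_generated[OF lines(1) diff(2) ne(2)] xd(2) by blast
  obtain \<chi>3 where 3: "x (q + e1) - x (q + e2) = rscale (b - c) \<chi>3"
    using HP1_generated[OF lines(1) diff(3) ne(3)] xd(3) by blast
  have "rscale (a - c) \<chi>2 = rscale (a - b) \<chi>1 + rscale (b - c) \<chi>3"
    unfolding 1[symmetric] 2[symmetric] 3[symmetric] by simp
  then have eq: "rscale (a - b) (\<chi>2 - \<chi>1) = rscale (b - c) (\<chi>3 - \<chi>2)"
    by (simp add: rscale_def prod_eq_iff algebra_simps)
  have "rscale (a - b) (\<chi>2 - \<chi>1) \<in> A (q + e1)" by (rule HP1_closed(4)[OF lines(1) diff(1)])
  moreover have "rscale (a - b) (\<chi>2 - \<chi>1) \<in> A (q + e1 + e2)"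
    unfolding eq by (rule HP1_closed(4)[OF lines(1) diff(3)])
  ultimately have "rscale (a - b) (\<chi>2 - \<chi>1) = 0"
    using HP1_disjoint[OF lines(1) lines(1) immersed_netD(4)[OF A]] by blast
  then have "\<chi>2 = \<chi>1" using ne(1) by (simp add: rscale_eq_0_iff)
  let ?y = "x q - rscale a \<chi>1"
  have "?y - x q = rscale a (- \<chi>1)" "?y - x (q + e1) = rscale b (- \<chi>1)"
    "?y - x (q + e2) = rscale c (- \<chi>1)"
    using 1 2 \<open>\<chi>2 = \<chi>1\<close> by (simp_all add: rscale_simps algebra_simps)
  then have "?y - x q \<in> B q \<and> ?y - x (q + e1) \<in> B (q + e1) \<and> ?y - x (q + e2) \<in> B (q + e2)"
    using HP1_closed(4)[OF lines(2)] abc by simp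
  moreover have "y = y'" if "y - x q \<in> B q" "y - x (q + e1) \<in> B (q + e1)"
    "y' - x q \<in> B q" "y' - x (q + e1) \<in> B (q + e1)" for y y'
  proof -
    have "y - y' \<in> B q" "y - y' \<in> B (q + e1)"
      using HP1_closed(5)[OF lines(2) that(1,3)] HP1_closed(5)[OF lines(2) that(2,4)] by simp_all
    then have "y - y' = 0" using HP1_disjoint[OF lines(2) lines(2) immersed_netD(3)[OF B]] by blast
    then show ?thesis by simp
  qed
  ultimately show ?thesis by blast
qed

text \<open>
  A prolongation \<open>x\<close> with values in \<open>B\<close> is parallel, so it vanishes nowhere if it does not vanish
  identically.  The dual section \<open>\<beta>\<close> in the complements of the lines \<open>A v\<close>, which is 1 on \<open>x\<close> at all
  black triangles around \<open>v\<close>, is a prolongation for the complements of \<open>B\<close>: at the corners of a black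
  triangle \<open>p\<close> the values of \<open>\<beta>\<close> agree on \<open>x p\<close>, hence modulo \<open>perp (B p)\<close>.
\<close>

lemma monodromies_dual_of_parallel:
  assumes torus: "discrete_torus \<Gamma>" and A: "immersed_net \<Gamma> A" and B: "immersed_net \<Gamma> B"
    and AB: "darboux_pair A B"
    and h: "h \<in> Hom \<Gamma>" and x: "equivariant \<Gamma> h x" "\<exists>p. x p \<noteq> 0" "\<And>p. x p \<in> B p"
      "\<And>p. x p - x (p - e1) \<in> A p" "\<And>p. x p - x (p - e2) \<in> A p"
  shows "h \<in> monodromies \<Gamma> (dual B)"
proof -
  note lines = immersed_netD(1)[OF A] immersed_netD(1)[OF B]
  note grp = lattice_group[OF torus]
  note ne = darboux_pair_distinct[OF AB]
  have step: "x (p + e1) = 0 \<longleftrightarrow> x p = 0" "x (p + e2) = 0 \<longleftrightarrow> x p = 0" for p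
  proof -
    have *: "u = 0 \<longleftrightarrow> v = 0" if "u \<in> B p" "v \<in> B q" "B p \<noteq> A q" "B q \<noteq> A q" "u - v \<in> A q" for u v p q
    proof
      assume "u = 0"
      then have "v \<in> A q" using HP1_closed(3)[OF lines(1) that(5)] by simp
      then show "v = 0" using HP1_disjoint lines that by metis
    next
      assume "v = 0"
      then have "u \<in> A q" using that(5) by simp
      then show "u = 0" using HP1_disjoint lines that by metis
    qed
    show "x (p + e1) = 0 \<longleftrightarrow> x p = 0"
      using *[OF x(3)[of p] x(3)[of "p + e1"] ne(2,1)] HP1_closed(3)[OF lines(1) x(4)[of "p + e1"]] by simp
    show "x (p + e2) = 0 \<longleftrightarrow> x p = 0"
      using *[OF x(3)[of p] x(3)[of "p + e2"] ne(3,1)] HP1_closed(3)[OF lines(1) x(5)[of "p + e2"]] by simp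
  qed
  \<comment> \<open>Zeros of \<open>x\<close> propagate along all edges.\<close>
  have "x 0 \<noteq> 0"
  proof
    assume "x 0 = 0"
    then have "x p = 0" for p by (rule vertex_induct) (rule step)+
    then show False using x(2) by blast
  qed
  then have nz: "x p \<noteq> 0" for p by (rule vertex_induct) (simp_all add: step)
  define \<beta> where "\<beta> v = (THE y. y \<in> perp (A v) \<and> herm y (x v) = 1)" for v
  have ex1: "\<exists>!y. y \<in> perp (A v) \<and> herm y (x v) = 1" for v
  proof (rule unit_covector[OF lines(1)])
    show "x v \<notin> A v" using HP1_disjoint[OF lines(2) lines(1) ne(1) x(3)] nz by blast
  qed
  have \<beta>: "\<beta> v \<in> perp (A v)" "herm (\<beta> v) (x v) = 1" for v
    using theI'[OF ex1[of v]] unfolding \<beta>_def by blast+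
  have \<beta>_eq: "\<beta> v = y" if "y \<in> perp (A v)" "herm y (x v) = 1" for v y
    using ex1[of v] \<beta>[of v] that by blast
  have \<beta>1: "herm (\<beta> (v + e1)) (x v) = 1" "herm (\<beta> (v + e2)) (x v) = 1" for v
  proof -
    have "herm (\<beta> (v + e1)) (x (v + e1) - x v) = 0" "herm (\<beta> (v + e2)) (x (v + e2) - x v) = 0"
      using \<beta>(1)[of "v + e1"] \<beta>(1)[of "v + e2"] x(4)[of "v + e1"] x(5)[of "v + e2"]
      by (auto simp: perp_def simp del: herm_simps)
    then show "herm (\<beta> (v + e1)) (x v) = 1" "herm (\<beta> (v + e2)) (x v) = 1"
      by (simp_all add: \<beta>)
  qed
  define k where "k p = rscale (\<beta> (- p)) quat_j" for p
  have "equivariant \<Gamma> h k"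
    unfolding equivariant_def
  proof (intro ballI allI)
    fix g p assume g: "g \<in> \<Gamma>"
    let ?h = "quat_of_complex (h g)"
    have hg: "h g \<noteq> 0" using h g by (auto simp: Hom_def)
    have "\<beta> (- p) = rscale (\<beta> (- (g + p))) (qconj (quat_of_complex (inverse (h g))))"
    proof (rule \<beta>_eq)
      have "A (- (g + p)) = A (- p)" using immersed_netD(2)[OF A grp(3)[OF g], of "- p"] by simp
      then show "rscale (\<beta> (- (g + p))) (qconj (quat_of_complex (inverse (h g)))) \<in> perp (A (- p))"
        using HP1_closed(4)[OF perp_HP1[OF lines(1)] \<beta>(1)] by metis
      have "x (- p) = rscale (x (- (g + p))) ?h"
        using equivariantD[OF x(1) g, of "- (g + p)"] by simp
      moreover have "quat_of_complex (inverse (h g)) * ?h = 1"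
        using hg by (metis left_inverse quat_of_complex_simps(1,2))
      ultimately show "herm (rscale (\<beta> (- (g + p))) (qconj (quat_of_complex (inverse (h g))))) (x (- p)) = 1"
        by (simp add: \<beta>)
    qed
    moreover have "qconj (quat_of_complex (inverse (h g))) * qconj ?h = 1"
      using hg by (metis right_inverse qconj_simps(1,7) quat_of_complex_simps(1,2))
    ultimately have "\<beta> (- (g + p)) = rscale (\<beta> (- p)) (qconj ?h)"
      by (simp add: rscale_simps(1,4))
    then show "k (g + p) = rscale (k p) ?h"
      by (simp add: k_def rscale_simps(1) qconj_complex_mult_j)
  qed
  moreover have "\<exists>p. k p \<noteq> 0"
    using \<beta>(2)[of 0] quat_j_nonzero by (intro exI[of _ 0]) (auto simp: k_def rscale_eq_0_iff)
  moreover have "k p - k (p - e1) \<in> dual B p \<and> k p - k (p - e2) \<in> dual B p" for p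
  proof -
    have "\<beta> (- p) - \<beta> (- p + e1) \<in> perp (B (- p))" "\<beta> (- p) - \<beta> (- p + e2) \<in> perp (B (- p))"
      unfolding perp_iff[OF lines(2) x(3) nz] by (simp_all only: herm_simps \<beta> \<beta>1 diff_self)
    moreover have "k p - k (p - e1) = rscale (\<beta> (- p) - \<beta> (- p + e1)) quat_j"
      "k p - k (p - e2) = rscale (\<beta> (- p) - \<beta> (- p + e2)) quat_j"
      by (simp_all add: k_def rscale_simps)
    ultimately show ?thesis
      unfolding dual_def using HP1_closed(4)[OF perp_HP1[OF lines(2)]] by metis
  qed
  ultimately show ?thesis using h unfolding monodromies_def by blast
qed

text \<open>
  The transformed section \<open>y\<close> inherits the monodromy by uniqueness.  If it vanishes, \<open>x\<close> has values in
  \<open>B\<close> and the dual parallel section takes over.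
\<close>

lemma monodromies_darboux_subset:
  assumes torus: "discrete_torus \<Gamma>" and A: "immersed_net \<Gamma> A" and B: "immersed_net \<Gamma> B"
    and AB: "darboux_pair A B"
  shows "monodromies \<Gamma> A \<subseteq> monodromies \<Gamma> B"
proof
  note lines = immersed_netD(1)[OF A] immersed_netD(1)[OF B]
  fix h assume "h \<in> monodromies \<Gamma> A"
  then obtain x where h: "h \<in> Hom \<Gamma>" and x: "equivariant \<Gamma> h x" "\<exists>p. x p \<noteq> 0"
      "\<And>p. x p - x (p - e1) \<in> A p" "\<And>p. x p - x (p - e2) \<in> A p"
    unfolding monodromies_def by blast
  define y where "y q = (THE y. y - x q \<in> B q \<and> y - x (q + e1) \<in> B (q + e1) \<and> y - x (q + e2) \<in> B (q + e2))" for q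
  note ex1 = darboux_lift[OF A B AB x(3,4)]
  have y: "y q - x q \<in> B q" "y q - x (q + e1) \<in> B (q + e1)" "y q - x (q + e2) \<in> B (q + e2)" for q
    using theI'[OF ex1[of q]] unfolding y_def by blast+
  show "h \<in> monodromies \<Gamma> B"
  proof (cases "\<exists>q. y q \<noteq> 0")
    case True
    have "equivariant \<Gamma> h y"
      unfolding equivariant_def
    proof (intro ballI allI)
      fix g q assume g: "g \<in> \<Gamma>"
      let ?y = "rscale (y q) (quat_of_complex (h g))"
      have *: "?y - x (g + p) \<in> B (g + p)" if "y q - x p \<in> B p" for p
        using HP1_closed(4)[OF lines(2) that, of "quat_of_complex (h g)"]
        by (simp add: equivariantD[OF x(1) g] immersed_netD(2)[OF B g] rscale_simps)
      have "?y - x (g + q) \<in> B (g + q)" "?y - x (g + q + e1) \<in> B (g + q + e1)"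
        "?y - x (g + q + e2) \<in> B (g + q + e2)"
        using *[OF y(1)] *[OF y(2)] *[OF y(3)] by (simp_all add: add.assoc)
      then show "y (g + q) = ?y" using ex1[of "g + q"] y[of "g + q"] by blast
    qed
    moreover have "y q - y (q - e1) \<in> B q \<and> y q - y (q - e2) \<in> B q" for q
      using HP1_closed(5)[OF lines(2) y(1)[of q]] y(2)[of "q - e1"] y(3)[of "q - e2"]
      by fastforce
    ultimately show ?thesis using h True unfolding monodromies_def by blast
  next
    case False
    then have "y p = 0" for p by blast
    then have "x p \<in> B p" for p using HP1_closed(3)[OF lines(2) y(1)[of p]] by simp
    then have "h \<in> monodromies \<Gamma> (dual B)"
      by (rule monodromies_dual_of_parallel[OF torus A B AB h x(1,2) _ x(3,4)])
    then show ?thesis using monodromies_dual_eq[OF torus B] by simp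
  qed
qed

text \<open>
  The reverse inclusion is the inclusion for the dual pair, read through the duality of spectra.
\<close>

lemma monodromies_darboux:
  assumes "discrete_torus \<Gamma>" "immersed_net \<Gamma> A" "immersed_net \<Gamma> B" "darboux_pair A B"
  shows "monodromies \<Gamma> B = monodromies \<Gamma> A"
proof
  show "monodromies \<Gamma> A \<subseteq> monodromies \<Gamma> B" by (rule monodromies_darboux_subset[OF assms])
  have "monodromies \<Gamma> (dual B) \<subseteq> monodromies \<Gamma> (dual A)"
    by (rule monodromies_darboux_subset[OF assms(1) _ _ darboux_pair_dual[OF assms(2-4)]])
      (rule immersed_net_dual[OF assms(1)], fact)+
  then show "monodromies \<Gamma> B \<subseteq> monodromies \<Gamma> A"
    by (simp add: monodromies_dual_eq assms)
qed

section \<open>Prolongation of holomorphic sections\<close>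

text \<open>
  An element of \<open>U\<^sub>b\<close> comes from a vector of \<open>\<H>\<^sup>2\<close>, which is unique since the lines at two corners of \<open>b\<close>
  are complementary.  These vectors form the prolongation; uniqueness passes the monodromy on to it.
\<close>

lemma Spec_quotient_bundle:
  assumes imm: "immersion \<Gamma> T L"
    and card: "\<And>b. card (corners T b) = 3"
    and shift: "\<And>g b. corners T (bshift T g b) = vshift T g ` corners T b"
    and corner: "\<And>p. \<exists>b. p \<in> corners T b"
  shows "Spec \<Gamma> T (quotient_bundle T L) = {h \<in> Hom \<Gamma>. \<exists>x.
      (\<forall>g\<in>\<Gamma>. \<forall>b. x (bshift T g b) = rscale (x b) (quat_of_complex (h g))) \<and>
      (\<exists>b. x b \<noteq> 0) \<and>
      (\<forall>b b' p. p \<in> corners T b \<longrightarrow> p \<in> corners T b' \<longrightarrow> x b - x b' \<in> L p)}"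
    (is "_ = {h \<in> Hom \<Gamma>. \<exists>x. ?P h x}")
proof -
  have L: "L p \<in> HP1" "g \<in> \<Gamma> \<Longrightarrow> L (vshift T g p) = L p" for p g
    using imm by (auto simp: immersion_def)
  have eqI: "x = y" if "\<And>p. p \<in> corners T b \<Longrightarrow> x - y \<in> L p" for x y :: quat2 and b
  proof -
    obtain p q where pq: "p \<in> corners T b" "q \<in> corners T b" "p \<noteq> q"
      using card[of b] by (metis card_3_iff insertCI)
    then have "L p \<noteq> L q" using imm unfolding immersion_def adjacent_def by metis
    then have "x - y = 0" using HP1_disjoint[OF L(1) L(1)] that pq by blast
    then show ?thesis by simp
  qed
  note q = quotient_bundle_def hbundle.simps qspace_simps[OF L(1)]
  show ?thesis
  proof (rule equalityI; rule subsetI)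
    fix h assume "h \<in> Spec \<Gamma> T (quotient_bundle T L)"
    then obtain \<psi> where h: "h \<in> Hom \<Gamma>"
      and \<psi>: "holomorphic_section T (quotient_bundle T L) \<psi>"
        "\<And>g p. g \<in> \<Gamma> \<Longrightarrow> \<psi> (vshift T g p) = qscale (quotient_qspace (L p)) (\<psi> p) (quat_of_complex (h g))"
        "\<exists>p. \<psi> p \<noteq> coset (L p) 0"
      unfolding Spec_def q by blast
    have "\<exists>x. restrict \<psi> (corners T b) = (\<lambda>p\<in>corners T b. coset (L p) x)" for b
      using \<psi>(1) unfolding holomorphic_section_def q by blast
    then obtain x where x: "\<And>b. restrict \<psi> (corners T b) = (\<lambda>p\<in>corners T b. coset (L p) (x b))"
      by metis
    have \<psi>x: "\<psi> p = coset (L p) (x b)" if "p \<in> corners T b" for p b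
      using fun_cong[OF x[of b], of p] that by simp
    have "x (bshift T g b) = rscale (x b) (quat_of_complex (h g))" if g: "g \<in> \<Gamma>" for g b
    proof (rule eqI)
      fix p assume "p \<in> corners T b"
      then have "coset (L p) (x (bshift T g b)) = \<psi> (vshift T g p)"
        using \<psi>x[of "vshift T g p" "bshift T g b"] by (simp add: shift L(2)[OF g])
      also have "\<dots> = coset (L p) (rscale (x b) (quat_of_complex (h g)))"
        using \<open>p \<in> corners T b\<close> by (simp add: \<psi>(2)[OF g] \<psi>x qspace_simps[OF L(1)])
      finally show "x (bshift T g b) - rscale (x b) (quat_of_complex (h g)) \<in> L p"
        by (simp add: coset_eq[OF L(1)])
    qed
    moreover have "\<exists>b. x b \<noteq> 0" using \<psi>(3) \<psi>x corner by metis
    moreover have "x b - x b' \<in> L p" if "p \<in> corners T b" "p \<in> corners T b'" for b b' p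
      using that \<psi>x coset_eq[OF L(1)] by metis
    ultimately show "h \<in> {h \<in> Hom \<Gamma>. \<exists>x. ?P h x}" using h by blast
  next
    fix h assume "h \<in> {h \<in> Hom \<Gamma>. \<exists>x. ?P h x}"
    then obtain x where h: "h \<in> Hom \<Gamma>"
      and x: "\<And>g b. g \<in> \<Gamma> \<Longrightarrow> x (bshift T g b) = rscale (x b) (quat_of_complex (h g))"
        "\<exists>b. x b \<noteq> 0" "\<And>b b' p. p \<in> corners T b \<Longrightarrow> p \<in> corners T b' \<Longrightarrow> x b - x b' \<in> L p"
      by blast
    define \<psi> where "\<psi> p = coset (L p) (x (SOME b. p \<in> corners T b))" for p
    have \<psi>x: "\<psi> p = coset (L p) (x b)" if "p \<in> corners T b" for p b
      unfolding \<psi>_def coset_eq[OF L(1)] using x(3) someI[of "\<lambda>b. p \<in> corners T b"] that by blast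
    have res: "restrict \<psi> (corners T b) = (\<lambda>p\<in>corners T b. coset (L p) (x b))" for b
      by (rule restrict_ext) (rule \<psi>x)
    have "holomorphic_section T (quotient_bundle T L) \<psi>"
      unfolding holomorphic_section_def q
    proof (intro conjI allI)
      show "\<psi> p \<in> range (coset (L p))" for p unfolding \<psi>_def by (rule rangeI)
      show "restrict \<psi> (corners T b) \<in> range (\<lambda>x. \<lambda>p\<in>corners T b. coset (L p) x)" for b
        unfolding res by (rule rangeI)
    qed
    moreover have "\<psi> (vshift T g p) = qscale (quotient_qspace (L p)) (\<psi> p) (quat_of_complex (h g))"
      if g: "g \<in> \<Gamma>" for g p
    proof -
      obtain b where b: "p \<in> corners T b" using corner by blast
      then have "vshift T g p \<in> corners T (bshift T g b)" by (simp add: shift)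
      then show ?thesis by (simp add: \<psi>x[OF b] \<psi>x L(2)[OF g] x(1)[OF g] qspace_simps[OF L(1)])
    qed
    moreover have "\<exists>p. \<psi> p \<noteq> coset (L p) 0"
    proof (rule ccontr)
      assume no: "\<not> ?thesis"
      have "x b = 0" for b
        by (rule eqI[of b]) (use no \<psi>x in \<open>metis coset_eq[OF L(1)]\<close>)
      then show False using x(2) by blast
    qed
    ultimately show "h \<in> Spec \<Gamma> T (quotient_bundle T L)"
      using h unfolding Spec_def q by blast
  qed
qed


section \<open>Regular combinatorics in coordinates\<close>

text \<open>
  What \<open>M\<close> and \<open>M'\<close> have in common: both the vertices and the black faces are indexed by \<open>\<int>\<^sup>2\<close>, in such a
  way that the face \<open>q\<close> has the corners \<open>q\<close>, \<open>q + e1\<close> and \<open>q + e2\<close>.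
\<close>

locale regular_cover =
  fixes T :: "('v, 'b) bw_cover" and V :: "vertex \<Rightarrow> 'v" and C :: "vertex \<Rightarrow> 'b"
  assumes bij_V: "bij V" and bij_C: "bij C"
    and vshift_V: "vshift T g (V p) = V (g + p)"
    and bshift_C: "bshift T g (C q) = C (g + q)"
    and corners_C: "corners T (C q) = {V q, V (q + e1), V (q + e2)}"
begin

lemma V_eq_iff: "V p = V q \<longleftrightarrow> p = q"
  using bij_V by (simp add: bij_def inj_eq)

lemma C_cases: obtains q where "b = C q"
  using bij_C by (metis bij_pointE)

lemma V_in_corners_iff: "V p \<in> corners T (C q) \<longleftrightarrow> q = p \<or> q = p - e1 \<or> q = p - e2"
  by (auto simp: corners_C V_eq_iff)

lemma card_corners_regular: "card (corners T b) = 3"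
  by (rule C_cases[of b]) (simp add: corners_C V_eq_iff e1_def e2_def zero_prod_def card_insert_if)

lemma corners_bshift_regular: "corners T (bshift T g b) = vshift T g ` corners T b"
  by (rule C_cases[of b]) (simp add: corners_C bshift_C vshift_V add.assoc)

lemma immersed_net_immersion:
  assumes "immersion \<Gamma> T L"
  shows "immersed_net \<Gamma> (\<lambda>p. L (V p))"
proof -
  have adj: "L (V p) \<noteq> L (V q)" if "V p \<in> corners T b" "V q \<in> corners T b" "p \<noteq> q" for p q b
    using assms that V_eq_iff unfolding immersion_def adjacent_def by metis
  have "L (V p) \<noteq> L (V (p + e1)) \<and> L (V p) \<noteq> L (V (p + e2)) \<and> L (V (p + e1)) \<noteq> L (V (p + e2))" for p
    by (intro conjI; rule adj[of _ "C p"]) (simp_all add: corners_C, simp_all add: e1_def e2_def zero_prod_def)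
  moreover have "L (V (g + p)) = L (V p)" if "g \<in> \<Gamma>" for g p
    using assms that unfolding immersion_def by (metis vshift_V)
  moreover have "L (V p) \<in> HP1" for p using assms unfolding immersion_def by blast
  ultimately show ?thesis unfolding immersed_net_def by blast
qed

lemma Spec_eq_monodromies:
  assumes imm: "immersion \<Gamma> T L"
  shows "Spec \<Gamma> T (quotient_bundle T L) = monodromies \<Gamma> (\<lambda>p. L (V p))"
proof -
  have lines: "L p \<in> HP1" for p using imm unfolding immersion_def by blast
  have corner: "\<exists>b. p \<in> corners T b" for p
  proof -
    obtain q where "p = V q" using bij_V by (metis bij_pointE)
    then show ?thesis using V_in_corners_iff[of q q] by blast
  qed
  show ?thesis
    unfolding Spec_quotient_bundle[OF imm card_corners_regular corners_bshift_regular corner]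
      monodromies_def
  proof (rule equalityI; rule subsetI)
    fix h assume "h \<in> {h \<in> Hom \<Gamma>. \<exists>x.
      (\<forall>g\<in>\<Gamma>. \<forall>b. x (bshift T g b) = rscale (x b) (quat_of_complex (h g))) \<and> (\<exists>b. x b \<noteq> 0) \<and>
      (\<forall>b b' p. p \<in> corners T b \<longrightarrow> p \<in> corners T b' \<longrightarrow> x b - x b' \<in> L p)}"
    then obtain x b where h: "h \<in> Hom \<Gamma>"
      and x: "\<And>g b. g \<in> \<Gamma> \<Longrightarrow> x (bshift T g b) = rscale (x b) (quat_of_complex (h g))" "x b \<noteq> 0"
        "\<And>b b' p. p \<in> corners T b \<Longrightarrow> p \<in> corners T b' \<Longrightarrow> x b - x b' \<in> L p"
      by blast
    have "equivariant \<Gamma> h (\<lambda>q. x (C q))" unfolding equivariant_def using x(1) bshift_C by metis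
    moreover have "\<exists>q. x (C q) \<noteq> 0" using x(2) C_cases by metis
    moreover have "x (C p) - x (C (p - e1)) \<in> L (V p) \<and> x (C p) - x (C (p - e2)) \<in> L (V p)" for p
      by (intro conjI x(3)) (simp_all add: V_in_corners_iff)
    ultimately show "h \<in> {h \<in> Hom \<Gamma>. \<exists>x. equivariant \<Gamma> h x \<and> (\<exists>p. x p \<noteq> 0) \<and>
        (\<forall>p. x p - x (p - e1) \<in> L (V p) \<and> x p - x (p - e2) \<in> L (V p))}"
      using h by blast
  next
    fix h assume "h \<in> {h \<in> Hom \<Gamma>. \<exists>x. equivariant \<Gamma> h x \<and> (\<exists>p. x p \<noteq> 0) \<and>
        (\<forall>p. x p - x (p - e1) \<in> L (V p) \<and> x p - x (p - e2) \<in> L (V p))}"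
    then obtain x p where h: "h \<in> Hom \<Gamma>" and x: "equivariant \<Gamma> h x" "x p \<noteq> 0"
      "\<And>p. x p - x (p - e1) \<in> L (V p)" "\<And>p. x p - x (p - e2) \<in> L (V p)"
      by blast
    define x' where "x' b = x (inv_into UNIV C b)" for b
    have x'C: "x' (C q) = x q" for q using bij_C by (simp add: x'_def bij_def)
    have "x' (bshift T g b) = rscale (x' b) (quat_of_complex (h g))" if "g \<in> \<Gamma>" for g b
      by (rule C_cases[of b]) (simp add: bshift_C x'C equivariantD[OF x(1) that])
    moreover have "x' (C p) \<noteq> 0" using x(2) by (simp add: x'C)
    moreover have "x' b - x' b' \<in> L v" if b: "v \<in> corners T b" "v \<in> corners T b'" for b b' v
    proof -
      obtain p where p: "v = V p" using bij_V by (metis bij_pointE)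
      have base: "x p - x' b \<in> L v" if "v \<in> corners T b" for b
      proof (rule C_cases[of b])
        fix q assume "b = C q"
        with that show ?thesis
          using x(3,4)[of p] HP1_closed(1)[OF lines] by (auto simp: p V_in_corners_iff x'C)
      qed
      show ?thesis using HP1_closed(5)[OF lines base[OF b(2)] base[OF b(1)]] by simp
    qed
    ultimately show "h \<in> {h \<in> Hom \<Gamma>. \<exists>x.
      (\<forall>g\<in>\<Gamma>. \<forall>b. x (bshift T g b) = rscale (x b) (quat_of_complex (h g))) \<and> (\<exists>b. x b \<noteq> 0) \<and>
      (\<forall>b b' p. p \<in> corners T b \<longrightarrow> p \<in> corners T b' \<longrightarrow> x b - x b' \<in> L p)}"
      using h by blast
  qed
qed

end

lemma bij_Black: "bij Black" and bij_White: "bij White"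
  by (metis bijI' black.exhaust black.inject, metis bijI' white.exhaust white.inject)

interpretation M: regular_cover M_cover "\<lambda>p. p" Black
proof
  show "corners M_cover (Black q) = {q, q + e1, q + e2}" for q
    by (cases q) (simp add: M_cover_def e1_def e2_def)
  show "bij (\<lambda>p :: vertex. p)" by (rule bijI') auto
qed (simp_all add: M_cover_def bij_Black)

interpretation M': regular_cover M'_cover Black White
proof
  show "corners M'_cover (White q) = {Black q, Black (q + e1), Black (q + e2)}" for q
    by (cases q) (simp add: M'_cover_def e1_def e2_def adjacent_blacks_eq)
qed (simp_all add: M'_cover_def bij_Black bij_White)

lemma edge_ends_White:
  "edge_ends (White q, q + e1) = {Black q, Black (q + e1)}"
  "edge_ends (White q, q + e2) = {Black (q + e2), Black q}"
  "edge_ends (White q, q + e1 + e2) = {Black (q + e1), Black (q + e2)}"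
  by (cases q; auto simp: edge_ends_def adjacent_blacks_eq e1_def e2_def)+

section \<open>Invariance of the spectral curve\<close>

text \<open>
  Trivial holonomy around a white triangle returns a vector of the first line to itself; the two
  intermediate vectors on its way complete the parallel section.
\<close>

lemma darboux_transform_pair:
  assumes L: "immersion \<Gamma> M_cover L" and D: "darboux_transform \<Gamma> L L'"
  shows "darboux_pair L (\<lambda>q. L' (Black q))"
proof -
  note D = D[unfolded darboux_transform_def]
  note flatness = conjunct2[OF conjunct2[OF conjunct2[OF D]], rule_format]
  have lines: "L p \<in> HP1" "L' b \<in> HP1" for p b
    using L conjunct1[OF D] unfolding immersion_def by blast+
  have ne: "L' (Black q) \<noteq> L q \<and> L' (Black q) \<noteq> L (q + e1) \<and> L' (Black q) \<noteq> L (q + e2)" for q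
  proof -
    have "\<forall>v\<in>black_corners (Black q). L' (Black q) \<noteq> L v"
      using conjunct1[OF conjunct2[OF conjunct2[OF D]]] by blast
    then show ?thesis by (cases q) (simp add: e1_def e2_def)
  qed
  have "\<exists>a b c. a \<in> L' (Black q) \<and> b \<in> L' (Black (q + e1)) \<and> c \<in> L' (Black (q + e2)) \<and>
      a \<noteq> 0 \<and> b \<noteq> 0 \<and> c \<noteq> 0 \<and>
      a - b \<in> L (q + e1) \<and> a - c \<in> L (q + e2) \<and> b - c \<in> L (q + e1 + e2)" for q
  proof -
    let ?F = "{(White q, v) | v. v \<in> white_corners (White q)}"
    have wc: "white_corners (White q) = {q + e1, q + e2, q + e1 + e2}"
      by (cases q) (simp add: e1_def e2_def)
    have F: "?F \<in> M'_faces" unfolding M'_faces_def by blast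
    have e: "(White q, q + e1) \<in> ?F" "(White q, q + e1 + e2) \<in> ?F" "(White q, q + e2) \<in> ?F"
      unfolding wc by blast+
    have "distinct [(White q, q + e1), (White q, q + e1 + e2), (White q, q + e2)]"
      "distinct [Black q, Black (q + e1), Black (q + e2)]"
      by (cases q; simp add: e1_def e2_def)+
    then have flat: "darboux_transport L L' (q + e1) (Black q) (Black (q + e1))
        O darboux_transport L L' (q + e1 + e2) (Black (q + e1)) (Black (q + e2))
        O darboux_transport L L' (q + e2) (Black (q + e2)) (Black q) = Id_on (L' (Black q))"
      using flatness[OF F e, of "Black q" "Black (q + e1)" "Black (q + e2)"] edge_ends_White[of q]
      unfolding snd_conv by blast
    obtain a where a: "a \<in> L' (Black q)" "a \<noteq> 0" using HP1_nonzero[OF lines(2)] by blast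
    then have "(a, a) \<in> darboux_transport L L' (q + e1) (Black q) (Black (q + e1))
        O darboux_transport L L' (q + e1 + e2) (Black (q + e1)) (Black (q + e2))
        O darboux_transport L L' (q + e2) (Black (q + e2)) (Black q)"
      unfolding flat by blast
    then obtain b c where bc: "b \<in> L' (Black (q + e1))" "c \<in> L' (Black (q + e2))"
        "coset (L (q + e1)) a = coset (L (q + e1)) b"
        "coset (L (q + e1 + e2)) b = coset (L (q + e1 + e2)) c"
        "coset (L (q + e2)) c = coset (L (q + e2)) a"
      unfolding darboux_transport_def by blast
    then have diff: "a - b \<in> L (q + e1)" "b - c \<in> L (q + e1 + e2)" "a - c \<in> L (q + e2)"
      by (metis coset_eq lines(1))+
    have "b \<noteq> 0" using HP1_disjoint[OF lines(2) lines(1), of "Black q" "q + e1" a] ne[of q] a diff by auto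
    moreover have "c \<noteq> 0"
      using HP1_disjoint[OF lines(2) lines(1), of "Black q" "q + e2" a] ne[of q] a diff by auto
    ultimately show ?thesis using a bc diff by blast
  qed
  then show ?thesis using ne unfolding darboux_pair_def by blast
qed

theorem theorem4p23:
  fixes \<Gamma> :: "vertex set"
    and L :: "vertex \<Rightarrow> quat2 set"
    and L' :: "black \<Rightarrow> quat2 set"
    and X :: "'a topology"
    and \<A> :: "('a set \<times> ('a \<Rightarrow> complex)) set"
    and h :: "'a \<Rightarrow> vertex \<Rightarrow> complex"
  assumes "discrete_torus \<Gamma>"
    and "immersion \<Gamma> M_cover L"
    and "genericity \<Gamma> (quotient_bundle M_cover L)"
    and "darboux_transform \<Gamma> L L'"
    and "immersion \<Gamma> M'_cover L'"
  shows "is_spectral_curve \<Gamma> M'_cover L' X \<A> h \<longleftrightarrow> is_spectral_curve \<Gamma> M_cover L X \<A> h"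
proof -
  have "monodromies \<Gamma> (\<lambda>q. L' (Black q)) = monodromies \<Gamma> L"
    using assms(1,2,4,5) M.immersed_net_immersion M'.immersed_net_immersion
    by (intro monodromies_darboux darboux_transform_pair) simp_all
  then have "Spec \<Gamma> M'_cover (quotient_bundle M'_cover L') = Spec \<Gamma> M_cover (quotient_bundle M_cover L)"
    using M.Spec_eq_monodromies[OF assms(2)] M'.Spec_eq_monodromies[OF assms(5)] by simp
  then show ?thesis by (simp add: is_spectral_curve_def)
qed

end
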